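(* On laminar instances, there is an $\mathcal{O}(\log m)$-competitive online algorithm for (preemptive) online machine minimization, where $m$ is the optimal number of machines. That is, there is an absolute constant $C$ such that, for every laminar instance admitting a feasible schedule on $m$ machines, the algorithm produces a feasible schedule on at most $C\cdot\max\{1,\log m\}\cdot m$ machines.
   Context: An instance is a finite set of jobs $J$; each job $j$ has processing time $p_j\in\mathbb{N}$, release date $r_j\in\mathbb{N}$ and deadline $d_j\in\mathbb{N}$, and interval $I(j)=[r_j,d_j)$. A feasible schedule processes each job $j$ for $p_j$ time units within $I(j)$; each machine processes at most one job at a time and no job runs on two machines simultaneously; preemption (and resumption on any machine) is allowed. In the online problem, a job becomes known only at its release date; the algorithm may open machines over time with irrevocable decisions, and its cost is the total number of machines opened. An online algorithm is $c$-competitive if on every instance admitting a feasible schedule on $m$ machines it produces a feasible schedule on at most $c\cdot m$ machines. An instance is laminar if for any two jobs $j,j'$ with $|I(j)\cap I(j')|>0$ we have $I(j)\subseteq I(j')$ or $I(j')\subseteq I(j)$. *)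

theory Defs
  imports "HOL-Analysis.Analysis"
begin

text \<open>
  The identifier only serves to distinguish jobs with the same parameters, so that an instance can
  be a set. As the parameters are part of the job itself, a set of jobs carries no information
  about jobs outside of it.
\<close>

datatype job =
  Job (job_id: nat) (proc_time: nat) (release: nat) (deadline: nat)

definition job_interval :: "job \<Rightarrow> real set" where
  "job_interval j = {real (release j)..<real (deadline j)}"

definition laminar :: "job set \<Rightarrow> bool" where
  "laminar J \<longleftrightarrow>
     (\<forall>j\<in>J. \<forall>j'\<in>J. measure lborel (job_interval j \<inter> job_interval j') > 0 \<longrightarrow>
        job_interval j \<subseteq> job_interval j' \<or> job_interval j' \<subseteq> job_interval j)"

text \<open>
  A schedule says which job, if any, is processed on machine \<open>i\<close> at time \<open>t\<close>. Time is continuous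
  (only the job parameters are integral), so jobs may be preempted at arbitrary times; the amount
  of processing a job receives is the Lebesgue measure of the set of times at which it runs.
  That a machine processes at most one job at a time is implicit in the type.
\<close>

type_synonym schedule = "real \<Rightarrow> nat \<Rightarrow> job option"

definition feasible_schedule :: "job set \<Rightarrow> nat set \<Rightarrow> schedule \<Rightarrow> bool" where
  "feasible_schedule J M S \<longleftrightarrow>
     (\<forall>t i j. S t i = Some j \<longrightarrow> i \<in> M \<and> j \<in> J \<and> t \<in> job_interval j) \<and>
     (\<forall>t i i' j. S t i = Some j \<and> S t i' = Some j \<longrightarrow> i = i') \<and>
     (\<forall>i j. {t. S t i = Some j} \<in> sets borel) \<and>
     (\<forall>j\<in>J. measure lborel {t. \<exists>i. S t i = Some j} = real (proc_time j))"

definition feasible_on :: "job set \<Rightarrow> nat \<Rightarrow> bool" where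
  "feasible_on J m \<longleftrightarrow> (\<exists>S. feasible_schedule J {..<m} S)"

text \<open>
  A deterministic online algorithm decides at each time \<open>t\<close>, given the jobs released up to and
  including time \<open>t\<close>, which machines are open and which job each machine processes. This covers
  algorithms that depend on their whole history: the jobs known at an earlier time can be
  recovered from the release dates, and hence so can all earlier decisions. The algorithm is told
  neither the number of jobs nor the optimal number of machines.
\<close>

type_synonym online_algorithm = "job set \<Rightarrow> real \<Rightarrow> nat set \<times> (nat \<Rightarrow> job option)"

definition released :: "job set \<Rightarrow> real \<Rightarrow> job set" where
  "released J t = {j \<in> J. real (release j) \<le> t}"

definition open_machines :: "online_algorithm \<Rightarrow> job set \<Rightarrow> real \<Rightarrow> nat set" where
  "open_machines A J t = fst (A (released J t) t)"

definition online_schedule :: "online_algorithm \<Rightarrow> job set \<Rightarrow> schedule" where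
  "online_schedule A J t = snd (A (released J t) t)"

definition all_opened :: "online_algorithm \<Rightarrow> job set \<Rightarrow> nat set" where
  "all_opened A J = (\<Union>t. open_machines A J t)"

text \<open>
  Opening a machine is irrevocable, and only open machines may be used.
\<close>

definition solves_online :: "online_algorithm \<Rightarrow> job set \<Rightarrow> bool" where
  "solves_online A J \<longleftrightarrow>
     mono (open_machines A J) \<and>
     (\<forall>t i. online_schedule A J t i \<noteq> None \<longrightarrow> i \<in> open_machines A J t) \<and>
     feasible_schedule J (all_opened A J) (online_schedule A J)"

text \<open>
  The competitive factor \<open>c\<close> may depend on the number \<open>m\<close> of machines of the offline solution.
\<close>

definition competitive_on ::
    "(job set \<Rightarrow> bool) \<Rightarrow> (nat \<Rightarrow> real) \<Rightarrow> online_algorithm \<Rightarrow> bool" where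
  "competitive_on P c A \<longleftrightarrow>
     (\<forall>J m. finite J \<longrightarrow> P J \<longrightarrow> feasible_on J m \<longrightarrow>
        solves_online A J \<and> finite (all_opened A J) \<and>
        real (card (all_opened A J)) \<le> c m * real m)"

end

theory Submission
  imports Defs "HOL-Library.List_Lexorder"
begin

text \<open>
  With migration, an algorithm only has to choose, in each unit time slot, a set of running jobs
  whose size is at most the number of open machines. The lower bound on the optimum \<open>m\<close> is that
  \<open>(\<Sum>j. card (T \<inter> slots j) - laxity j) \<le> m * card T\<close> for every set \<open>T\<close> of slots.

  Jobs whose laxity is at least a constant fraction of their interval are scheduled by EDF on
  \<open>O(m)\<close> machines: if such a job fails, then the jobs nested in it fill too much of its interval.

  For the other jobs, all jobs whose interval contains the current slot run, except that whenever
  there are already \<open>M\<close> of them, an arriving job suspends one of these for its whole interval. The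
  laxity of each job is split into \<open>M\<close> budgets, one for each rank (counted from the innermost) it
  may have when it is suspended. If all candidates have exhausted budgets, then tracing back who was
  charged to them yields a set \<open>T\<close> of slots, each covered by \<open>M\<close> jobs \<open>g\<close> with
  \<open>laxity g \<le> M * card (T \<inter> slots g)\<close>. Replacing \<open>T\<close> by the union of the \<open>4 m\<close>-th innermost of
  these jobs doubles all \<open>card (T \<inter> slots g)\<close> and costs \<open>4 m\<close> layers; after \<open>O(log M)\<close> rounds this
  contradicts the lower bound, unless \<open>M = O(m log m)\<close>.

  The unknown \<open>m\<close> is guessed by doubling.
\<close>

section \<open>Ranks\<close>

definition rank_in :: "('a \<Rightarrow> 'b::linorder) \<Rightarrow> 'a set \<Rightarrow> 'a \<Rightarrow> nat" where
  "rank_in f X x = card {y \<in> X. f x < f y}"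

lemma rank_less_card:
  assumes "finite X" "x \<in> X"
  shows "rank_in f X x < card X"
  unfolding rank_in_def using assms by (intro psubset_card_mono) auto

lemma rank_antimono:
  assumes "finite X" "f x \<le> f y"
  shows "rank_in f X y \<le> rank_in f X x"
  unfolding rank_in_def using assms by (intro card_mono) auto

lemma rank_strict:
  assumes "finite X" "y \<in> X" "f x < f y"
  shows "rank_in f X y < rank_in f X x"
  unfolding rank_in_def using assms by (intro psubset_card_mono) auto

lemma rank_less_iff:
  assumes "finite X" "y \<in> X" "x \<in> X"
  shows "rank_in f X y < rank_in f X x \<longleftrightarrow> f x < f y"
  using rank_strict[OF assms(1,2)] rank_antimono[OF assms(1), of f y x] by (meson not_le)

lemma bij_betw_rank:
  assumes "finite X" "inj_on f X"
  shows "bij_betw (rank_in f X) X {..<card X}"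
proof -
  have inj: "inj_on (rank_in f X) X"
    using assms by (intro inj_onI) (metis inj_onD linorder_neqE nat_neq_iff rank_less_iff)
  have "rank_in f X ` X \<subseteq> {..<card X}"
    using rank_less_card[OF assms(1)] by auto
  then have "rank_in f X ` X = {..<card X}"
    using inj by (intro card_subset_eq) (auto simp: card_image)
  with inj show ?thesis by (simp add: bij_betw_def)
qed

definition top_set :: "('a \<Rightarrow> 'b::linorder) \<Rightarrow> nat \<Rightarrow> 'a set \<Rightarrow> 'a set" where
  "top_set f n X = {x \<in> X. rank_in f X x < n}"

lemma top_set_subset: "top_set f n X \<subseteq> X"
  by (auto simp: top_set_def)

lemma card_top_set:
  assumes "finite X" "inj_on f X"
  shows "card (top_set f n X) = min n (card X)"
proof -
  have "bij_betw (rank_in f X) (top_set f n X) ({..<card X} \<inter> {..<n})"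
    using bij_betw_rank[OF assms] unfolding bij_betw_def top_set_def
    by (auto simp: inj_on_def)
  then have "card (top_set f n X) = card ({..<card X} \<inter> {..<n})"
    by (rule bij_betw_same_card)
  also have "{..<card X} \<inter> {..<n} = {..<min n (card X)}"
    by auto
  finally show ?thesis
    by simp
qed

text \<open>An element above \<open>x\<close> has the same rank in \<open>X\<close> as among the
  elements above \<open>x\<close>, so the set counted is the top \<open>n\<close> of those; at least
  \<open>n\<close> of them exist because \<open>x\<close> was not chosen.\<close>

lemma top_set_not_in:
  assumes "finite X" "inj_on f X" "x \<in> X" "x \<notin> top_set f n X"
  shows "card {y \<in> top_set f n X. f x < f y} = n"
proof -
  let ?Y = "{y \<in> X. f x < f y}"
  have "rank_in f X y = rank_in f ?Y y" if "y \<in> ?Y" for y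
    using that unfolding rank_in_def by (intro arg_cong[where f = card]) auto
  then have "{y \<in> top_set f n X. f x < f y} = top_set f n ?Y"
    unfolding top_set_def by auto
  moreover have "n \<le> card ?Y"
    using assms(3,4) by (auto simp: top_set_def rank_in_def)
  ultimately show ?thesis
    using card_top_set[of ?Y f n] assms(1,2) by (simp add: inj_on_def)
qed

text \<open>Lists of integers are not well-founded under the lexicographic order, so the induction
  measure is the number of smaller elements in \<open>X\<close>.\<close>

lemma finite_ranked_induct:
  fixes f :: "'a \<Rightarrow> 'b::linorder"
  assumes "finite X" "x \<in> X"
    and step: "\<And>x. x \<in> X \<Longrightarrow> (\<And>y. y \<in> X \<Longrightarrow> f y < f x \<Longrightarrow> P y) \<Longrightarrow> P x"
  shows "P x"
  using assms(2)
proof (induction "card {y \<in> X. f y < f x}" arbitrary: x rule: less_induct)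
  case less
  show ?case
  proof (rule step[OF less.prems])
    fix y assume "y \<in> X" "f y < f x"
    then show "P y"
      using assms(1) by (intro less.hyps psubset_card_mono) auto
  qed
qed

section \<open>Jobs and time slots\<close>

text \<open>Slot \<open>t\<close> stands for the time interval \<open>{t..<t + 1}\<close>.\<close>

definition slots :: "job \<Rightarrow> nat set" where
  "slots j = {release j..<deadline j}"

definition laxity :: "job \<Rightarrow> nat" where
  "laxity j = card (slots j) - proc_time j"

lemma finite_slots [simp]: "finite (slots j)"
  by (simp add: slots_def)

text \<open>Among jobs with intersecting intervals of a laminar instance, a larger key means a smaller
  interval.\<close>

definition key :: "job \<Rightarrow> int list" where
  "key j = [int (release j), - int (deadline j), int (job_id j), int (proc_time j)]"

lemma inj_key: "inj_on key A"
  proof (rule inj_onI)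
  fix x y assume "key x = key y"
  then show "x = y"
    by (cases x; cases y) (simp add: key_def)
qed

lemma key_eq_iff [simp]: "key x = key y \<longleftrightarrow> x = y"
  using inj_key[of UNIV] by (auto simp: inj_on_def)

definition laminar_slots :: "job set \<Rightarrow> bool" where
  "laminar_slots J \<longleftrightarrow> (\<forall>j\<in>J. \<forall>j'\<in>J. slots j \<inter> slots j' \<noteq> {} \<longrightarrow>
     slots j \<subseteq> slots j' \<or> slots j' \<subseteq> slots j)"

lemma laminar_slots_mono: "laminar_slots J \<Longrightarrow> J' \<subseteq> J \<Longrightarrow> laminar_slots J'"
  unfolding laminar_slots_def by blast

lemma laminar_imp_laminar_slots:
  assumes "laminar J"
  shows "laminar_slots J"
  unfolding laminar_slots_def
proof (intro ballI impI)
  fix j k assume jk: "j \<in> J" "k \<in> J" "slots j \<inter> slots k \<noteq> {}"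
  let ?a = "max (real (release j)) (real (release k))"
  let ?b = "min (real (deadline j)) (real (deadline k))"
  have ab: "?a < ?b" and ne: "release j < deadline j" "release k < deadline k"
    using jk(3) by (auto simp: slots_def)
  have "job_interval j \<inter> job_interval k = {?a..<?b}"
    by (auto simp: job_interval_def)
  then have "measure lborel (job_interval j \<inter> job_interval k) > 0"
    using ab by simp
  then have "job_interval j \<subseteq> job_interval k \<or> job_interval k \<subseteq> job_interval j"
    using assms jk by (simp add: laminar_def)
  then show "slots j \<subseteq> slots k \<or> slots k \<subseteq> slots j"
    using ne by (auto simp: job_interval_def slots_def atLeastLessThan_subset_iff)
qed

text \<open>Under the opposite inclusion, \<open>key x \<le> key y\<close> forces equal release
  dates and then equal deadlines.\<close>

lemma slots_subset_of_key:
  assumes "laminar_slots J" "x \<in> J" "y \<in> J" "slots x \<inter> slots y \<noteq> {}" "key x \<le> key y"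
  shows "slots y \<subseteq> slots x"
proof -
  have "slots x \<subseteq> slots y \<or> slots y \<subseteq> slots x"
    using assms by (auto simp: laminar_slots_def)
  moreover have "slots y \<subseteq> slots x" if "slots x \<subseteq> slots y"
    using that assms(4,5) by (auto simp: slots_def key_def split: if_splits)
  ultimately show ?thesis by blast
qed

text \<open>Each summand, truncated at 0, is the work on \<open>j\<close> that cannot be moved out
  of \<open>T\<close>: \<open>proc_time j\<close> minus the number of slots of \<open>j\<close>
  outside \<open>T\<close>. The analysis of both schedulers uses feasibility only in this
  form.\<close>

definition load_bounded :: "nat \<Rightarrow> job set \<Rightarrow> bool" where
  "load_bounded m J \<longleftrightarrow>
     (\<forall>j\<in>J. proc_time j \<le> card (slots j)) \<and>
     (\<forall>T. finite T \<longrightarrow> (\<Sum>j\<in>J. card (T \<inter> slots j) - laxity j) \<le> m * card T)"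

lemma load_boundedD:
  assumes "load_bounded m J" "finite J" "H \<subseteq> J" "finite T"
  shows "(\<Sum>j\<in>H. card (T \<inter> slots j) - laxity j) \<le> m * card T"
proof -
  have "(\<Sum>j\<in>H. card (T \<inter> slots j) - laxity j) \<le> (\<Sum>j\<in>J. card (T \<inter> slots j) - laxity j)"
    using assms by (intro sum_mono2) auto
  also have "\<dots> \<le> m * card T"
    using assms by (auto simp: load_bounded_def)
  finally show ?thesis .
qed

lemma load_bounded_mono:
  "load_bounded m J \<Longrightarrow> finite J \<Longrightarrow> J' \<subseteq> J \<Longrightarrow> load_bounded m J'"
  using load_boundedD[of m J J'] by (auto simp: load_bounded_def)

text \<open>The condition \<open>0 \<le> t\<close> matters because \<open>nat\<close> sends all
  negative floors to slot 0.\<close>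

definition unit_slots :: "nat set \<Rightarrow> real set" where
  "unit_slots X = {t. 0 \<le> t \<and> nat \<lfloor>t\<rfloor> \<in> X}"

lemma unit_slots_eq: "unit_slots X = (\<Union>n\<in>X. {real n..<real n + 1})"
proof -
  have "t \<in> unit_slots X \<longleftrightarrow> (\<exists>n\<in>X. t \<in> {real n..<real n + 1})" for t
  proof -
    have *: "t \<in> {real n..<real n + 1} \<longleftrightarrow> 0 \<le> t \<and> nat \<lfloor>t\<rfloor> = n" for n
      by (auto simp: nat_eq_iff floor_eq_iff)
    show ?thesis
      unfolding unit_slots_def * by blast
  qed
  then show ?thesis by blast
qed

lemma unit_slots_measurable [measurable]: "unit_slots X \<in> sets borel"
  unfolding unit_slots_eq by (intro sets.countable_UN') auto

lemma emeasure_unit_slots: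
  assumes "finite X"
  shows "emeasure lborel (unit_slots X) = ennreal (card X)"
proof -
  have "disjoint_family_on (\<lambda>n. {real n..<real n + 1}) X"
    by (auto simp: disjoint_family_on_def)
  then have "emeasure lborel (unit_slots X) = (\<Sum>n\<in>X. emeasure lborel {real n..<real n + 1})"
    unfolding unit_slots_eq using assms by (intro sum_emeasure[symmetric]) auto
  then show ?thesis by (simp add: ennreal_of_nat_eq_real_of_nat)
qed

lemma measure_unit_slots: "finite X \<Longrightarrow> measure lborel (unit_slots X) = real (card X)"
  by (simp add: measure_def emeasure_unit_slots)

lemma fmeasurable_unit_slots: "finite X \<Longrightarrow> unit_slots X \<in> fmeasurable lborel"
  by (intro fmeasurableI) (auto simp: emeasure_unit_slots)

lemma unit_slots_slots: "unit_slots (slots j) = job_interval j"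
proof -
  have "t \<in> unit_slots (slots j) \<longleftrightarrow> t \<in> job_interval j" for t
    by (auto simp: unit_slots_def slots_def job_interval_def le_nat_iff nat_less_iff
        le_floor_iff floor_less_iff)
  then show ?thesis by blast
qed

text \<open>At most \<open>card (slots j - T)\<close> units of \<open>j\<close> fit outside
  \<open>T\<close>; inside, each machine processes its jobs at disjoint times and so supplies at
  most \<open>card T\<close>.\<close>

lemma feasible_imp_load_bounded:
  assumes "feasible_on J m" "finite J"
  shows "load_bounded m J"
proof -
  obtain S where S: "feasible_schedule J {..<m} S"
    using assms by (auto simp: feasible_on_def)
  define E where "E i j = {t. S t i = Some j}" for i j
  define W where "W j = {t. \<exists>i. S t i = Some j}" for j
  have E_meas [measurable]: "E i j \<in> sets borel" for i j
    using S by (auto simp: feasible_schedule_def E_def)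
  have W_eq: "W j = (\<Union>i<m. E i j)" for j
    using S by (auto simp: feasible_schedule_def E_def W_def)
  have W_meas [measurable]: "W j \<in> sets borel" for j
    unfolding W_eq by measurable
  have W_sub: "W j \<subseteq> unit_slots (slots j)" for j
    using S by (auto simp: feasible_schedule_def W_def unit_slots_slots)
  have W_measure: "measure lborel (W j) = real (proc_time j)" if "j \<in> J" for j
    using S that by (auto simp: feasible_schedule_def W_def)
  have W_fm: "W j \<in> fmeasurable lborel" for j
    using W_sub by (intro fmeasurableI2[OF fmeasurable_unit_slots[of "slots j"]]) auto
  have fit: "proc_time j \<le> card (slots j)" if "j \<in> J" for j
  proof -
    have "measure lborel (W j) \<le> measure lborel (unit_slots (slots j))"
      by (intro measure_mono_fmeasurable W_sub fmeasurable_unit_slots) auto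
    then show ?thesis
      using W_measure[OF that] by (simp add: measure_unit_slots)
  qed
  have load: "(\<Sum>j\<in>J. card (T \<inter> slots j) - laxity j) \<le> m * card T" if T: "finite T" for T
  proof -
    let ?U = "unit_slots T"
    have U_fm: "?U \<in> fmeasurable lborel" by (rule fmeasurable_unit_slots[OF T])
    have low: "real (card (T \<inter> slots j) - laxity j) \<le> measure lborel (W j \<inter> ?U)" if "j \<in> J" for j
    proof -
      have fm: "unit_slots (slots j - T) \<in> fmeasurable lborel"
        by (intro fmeasurable_unit_slots) auto
      have "W j \<subseteq> (W j \<inter> ?U) \<union> unit_slots (slots j - T)"
        using W_sub[of j] by (auto simp: unit_slots_def)
      then have "measure lborel (W j) \<le> measure lborel ((W j \<inter> ?U) \<union> unit_slots (slots j - T))"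
        using W_fm U_fm fm by (intro measure_mono_fmeasurable) auto
      also have "\<dots> \<le> measure lborel (W j \<inter> ?U) + measure lborel (unit_slots (slots j - T))"
        by (intro measure_Un_le) auto
      finally have "real (proc_time j) \<le> measure lborel (W j \<inter> ?U) + real (card (slots j - T))"
        using W_measure[OF that] by (simp add: measure_unit_slots)
      moreover have "card (slots j) = card (slots j - T) + card (T \<inter> slots j)"
        by (metis Int_commute card_Diff_subset_Int card_mono finite_Int finite_slots inf_le1
            le_add_diff_inverse2)
      ultimately have "real (card (T \<inter> slots j)) - real (laxity j) \<le> measure lborel (W j \<inter> ?U)"
        using fit[OF that] by (simp add: laxity_def)
      then show ?thesis
        using measure_nonneg[of lborel "W j \<inter> ?U"] by linarith
    qed
    have "real (\<Sum>j\<in>J. card (T \<inter> slots j) - laxity j) \<le> (\<Sum>j\<in>J. measure lborel (W j \<inter> ?U))"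
      unfolding of_nat_sum by (intro sum_mono low)
    also have "\<dots> \<le> (\<Sum>j\<in>J. \<Sum>i<m. measure lborel (E i j \<inter> ?U))"
    proof (rule sum_mono)
      fix j
      have eq: "W j \<inter> ?U = (\<Union>i<m. E i j \<inter> ?U)" by (auto simp: W_eq)
      show "measure lborel (W j \<inter> ?U) \<le> (\<Sum>i<m. measure lborel (E i j \<inter> ?U))"
        unfolding eq by (rule measure_UNION_le) auto
    qed
    also have "\<dots> = (\<Sum>i<m. \<Sum>j\<in>J. measure lborel (E i j \<inter> ?U))"
      by (rule sum.swap)
    also have "\<dots> \<le> (\<Sum>i<m. measure lborel ?U)"
    proof (rule sum_mono)
      fix i
      have fin: "emeasure lborel (E i j \<inter> ?U) \<noteq> \<infinity>" for j
        using emeasure_mono[of "E i j \<inter> ?U" ?U lborel] U_fm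
        by (auto simp: fmeasurable_def top_unique)
      have "(\<Sum>j\<in>J. measure lborel (E i j \<inter> ?U)) = measure lborel (\<Union>j\<in>J. E i j \<inter> ?U)"
        using assms(2) fin by (intro measure_finite_Union[symmetric])
          (auto simp: disjoint_family_on_def E_def[abs_def] intro: E_meas[unfolded E_def])
      also have "\<dots> \<le> measure lborel ?U"
        using U_fm assms(2) by (intro measure_mono_fmeasurable) auto
      finally show "(\<Sum>j\<in>J. measure lborel (E i j \<inter> ?U)) \<le> measure lborel ?U" .
    qed
    also have "\<dots> = real (m * card T)"
      using T by (simp add: measure_unit_slots)
    finally show ?thesis by linarith
  qed
  show ?thesis
    unfolding load_bounded_def using fit load by auto
qed

lemma double_count:
  assumes "finite A" "finite B"
  shows "(\<Sum>x\<in>A. card {y \<in> B. R x y}) = (\<Sum>y\<in>B. card {x \<in> A. R x y})"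
  using assms by (intro sum_multicount_gen) auto

definition released_by :: "job set \<Rightarrow> nat \<Rightarrow> job set" where
  "released_by J t = {j \<in> J. release j \<le> t}"

section \<open>Loose jobs\<close>

definition pending :: "job set \<Rightarrow> (job \<Rightarrow> nat) \<Rightarrow> nat \<Rightarrow> job set" where
  "pending J c t = {j \<in> J. t \<in> slots j \<and> c j < proc_time j}"

primrec edf_work :: "nat \<Rightarrow> job set \<Rightarrow> nat \<Rightarrow> job \<Rightarrow> nat" where
  "edf_work M J 0 = (\<lambda>_. 0)"
| "edf_work M J (Suc t) = (\<lambda>j. edf_work M J t j +
     (if j \<in> top_set key M (pending J (edf_work M J t) t) then 1 else 0))"

text \<open>On laminar instances, earliest deadline first amounts to preferring the largest key.\<close>

definition edf :: "nat \<Rightarrow> job set \<Rightarrow> nat \<Rightarrow> job set" where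
  "edf M J t = top_set key M (pending J (edf_work M J t) t)"

lemma edf_subset: "edf M J t \<subseteq> {j \<in> J. t \<in> slots j}"
  unfolding edf_def by (rule order_trans[OF top_set_subset]) (auto simp: pending_def)

lemma card_edf_le: "finite J \<Longrightarrow> card (edf M J t) \<le> M"
  unfolding edf_def by (subst card_top_set) (auto simp: inj_key pending_def)

text \<open>A job is never pending before its release, so later arrivals cannot influence the
  decisions in earlier slots.\<close>

lemma edf_work_released_by: "s \<le> t \<Longrightarrow> edf_work M (released_by J t) s = edf_work M J s"
proof (induction s)
  case (Suc s)
  have "pending (released_by J t) c s = pending J c s" for c
    using Suc.prems by (auto simp: pending_def released_by_def slots_def)
  with Suc show ?case by simp
qed simp

lemma edf_released_by: "edf M (released_by J t) t = edf M J t"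
proof -
  have "pending (released_by J t) c t = pending J c t" for c
    by (auto simp: pending_def released_by_def slots_def)
  then show ?thesis by (simp add: edf_def edf_work_released_by)
qed

lemma edf_work_eq: "edf_work M J t j = card {s \<in> {..<t}. j \<in> edf M J s}"
proof (induction t)
  case (Suc t)
  have "{s \<in> {..<Suc t}. j \<in> edf M J s} =
        (if j \<in> edf M J t then insert t else id) {s \<in> {..<t}. j \<in> edf M J s}"
    by (auto simp: less_Suc_eq)
  then show ?case
    using Suc by (auto simp: edf_def)
qed simp

lemma edf_work_le: "edf_work M J t j \<le> proc_time j"
  by (induction t) (auto simp: top_set_def pending_def)

lemma card_edf_slots_le:
  assumes "finite I"
  shows "card {t \<in> I. j \<in> edf M J t} \<le> proc_time j"
proof -
  have "card {t \<in> I. j \<in> edf M J t} \<le> card {s \<in> {..<Suc (Max I)}. j \<in> edf M J s}"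
    using assms by (intro card_mono) (auto simp: less_Suc_eq_le)
  then show ?thesis
    using edf_work_le[of M J "Suc (Max I)" j] by (simp only: edf_work_eq)
qed

lemma edf_completes:
  assumes "finite J" "laminar_slots J" and load: "load_bounded m J" and "0 < m"
    and j: "j \<in> J" and loose: "card (slots j) < 8 * laxity j"
  shows "proc_time j \<le> card {t \<in> slots j. j \<in> edf (8 * m) J t}"
proof (rule ccontr)
  let ?M = "8 * m"
  let ?R = "edf ?M J"
  assume "\<not> ?thesis"
  then have less: "card {t \<in> slots j. j \<in> ?R t} < proc_time j" by simp
  define I where "I = {t \<in> slots j. j \<notin> ?R t}"
  define H where "H = {y \<in> J. slots y \<subseteq> slots j}"
  have fin: "finite I" "finite H" using assms(1) by (auto simp: I_def H_def)
  have fit: "proc_time y \<le> card (slots y)" if "y \<in> J" for y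
    using load that by (auto simp: load_bounded_def)
  \<comment> \<open>While unfinished, \<open>j\<close> is pending, so only \<open>8 * m\<close>
    running jobs of larger key can keep it idle, and laminarity nests these in
    \<open>j\<close>.\<close>
  have busy: "card {y \<in> H. y \<in> ?R t} \<ge> ?M" if t: "t \<in> I" for t
  proof -
    have "edf_work ?M J t j \<le> card {t \<in> slots j. j \<in> ?R t}"
      unfolding edf_work_eq using edf_subset by (intro card_mono) auto
    then have "j \<in> pending J (edf_work ?M J t) t"
      using t j less by (auto simp: pending_def I_def)
    then have "card {y \<in> ?R t. key j < key y} = ?M"
      using t assms(1) unfolding edf_def I_def
      by (intro top_set_not_in) (auto simp: pending_def inj_key)
    moreover have "{y \<in> ?R t. key j < key y} \<subseteq> {y \<in> H. y \<in> ?R t}"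
    proof
      fix y assume y: "y \<in> {y \<in> ?R t. key j < key y}"
      then have "y \<in> J" "t \<in> slots y" using edf_subset by blast+
      then have "slots y \<subseteq> slots j"
        using t y j assms(2) by (intro slots_subset_of_key[of J]) (auto simp: I_def)
      with y \<open>y \<in> J\<close> show "y \<in> {y \<in> H. y \<in> ?R t}" by (auto simp: H_def)
    qed
    ultimately show ?thesis
      using card_mono[of "{y \<in> H. y \<in> ?R t}" "{y \<in> ?R t. key j < key y}"] fin by simp
  qed
  have "?M * card I = (\<Sum>t\<in>I. ?M)" by simp
  also have "\<dots> \<le> (\<Sum>t\<in>I. card {y \<in> H. y \<in> ?R t})" by (intro sum_mono busy)
  also have "\<dots> = (\<Sum>y\<in>H. card {t \<in> I. y \<in> ?R t})" by (rule double_count[OF fin])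
  \<comment> \<open>For a nested job, the summand in the load bound for \<open>T = slots j\<close>
    is its full processing time.\<close>
  also have "\<dots> \<le> (\<Sum>y\<in>H. card (slots j \<inter> slots y) - laxity y)"
  proof (rule sum_mono)
    fix y assume "y \<in> H"
    then have "slots j \<inter> slots y = slots y" "proc_time y \<le> card (slots y)"
      using fit by (auto simp: H_def)
    then show "card {t \<in> I. y \<in> ?R t} \<le> card (slots j \<inter> slots y) - laxity y"
      using card_edf_slots_le[OF fin(1)] by (simp add: laxity_def)
  qed
  also have "\<dots> \<le> m * card (slots j)"
    using load assms(1) by (intro load_boundedD) (auto simp: H_def)
  \<comment> \<open>So \<open>j\<close> is idle in at most an eighth of its interval, hence in fewer
    than \<open>laxity j\<close> slots, whereas failing takes more than \<open>laxity j\<close> idle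
    slots.\<close>
  finally have "8 * card I \<le> card (slots j)"
    using \<open>0 < m\<close> by simp
  moreover have "card (slots j) = card I + card {t \<in> slots j. j \<in> ?R t}"
    unfolding I_def by (subst card_Un_disjoint[symmetric]) (auto intro: arg_cong[where f = card])
  ultimately show False
    using less loose by (simp add: laxity_def)
qed

section \<open>Critical pairs of tight jobs\<close>

text \<open>\<open>D\<close> consists of the maximal members of \<open>F\<close>.\<close>

lemma laminar_disjoint_cover:
  assumes "finite F" and laminar: "\<And>A B. A \<in> F \<Longrightarrow> B \<in> F \<Longrightarrow> A \<inter> B \<noteq> {} \<Longrightarrow> A \<subseteq> B \<or> B \<subseteq> A"
  obtains D where "D \<subseteq> F" "disjoint D" "\<And>A. A \<in> F \<Longrightarrow> \<exists>B\<in>D. A \<subseteq> B"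
proof
  let ?D = "{A \<in> F. \<forall>B\<in>F. A \<subseteq> B \<longrightarrow> A = B}"
  show "disjoint ?D"
  proof (rule disjointI)
    fix A B assume *: "A \<in> ?D" "B \<in> ?D" "A \<noteq> B"
    then have "\<not> A \<subseteq> B" "\<not> B \<subseteq> A" by auto
    then show "A \<inter> B = {}" using laminar[of A B] * by auto
  qed
  show "\<exists>B\<in>?D. A \<subseteq> B" if "A \<in> F" for A
    using finite_has_maximal2[OF assms(1) that] by blast
qed auto

lemma card_Int_disjoint_Union:
  assumes "finite D" "disjoint D" "\<And>A. A \<in> D \<Longrightarrow> finite A"
  shows "card (T \<inter> \<Union>D) = (\<Sum>A\<in>D. card (T \<inter> A))"
  unfolding Int_Union using assms
  by (intro card_UN_disjoint) (auto simp: disjoint_def)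

lemma disjoint_density:
  assumes "finite D" "disjoint D" "\<And>A. A \<in> D \<Longrightarrow> finite A"
    and "\<And>A. A \<in> D \<Longrightarrow> c * card (T \<inter> A) \<le> card A"
  shows "c * card (T \<inter> \<Union>D) \<le> card (\<Union>D)"
proof -
  have "c * card (T \<inter> \<Union>D) = (\<Sum>A\<in>D. c * card (T \<inter> A))"
    using card_Int_disjoint_Union[OF assms(1-3)] by (simp add: sum_distrib_left)
  also have "\<dots> \<le> (\<Sum>A\<in>D. card (UNIV \<inter> A))"
    using assms(4) by (intro sum_mono) simp
  also have "\<dots> = card (UNIV \<inter> \<Union>D)"
    using card_Int_disjoint_Union[OF assms(1-3)] by metis
  finally show ?thesis by simp
qed

text \<open>The maximal members are disjoint and have the same union, so it suffices to sum over
  them.\<close>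

lemma laminar_density:
  assumes "finite F" "\<And>A B. A \<in> F \<Longrightarrow> B \<in> F \<Longrightarrow> A \<inter> B \<noteq> {} \<Longrightarrow> A \<subseteq> B \<or> B \<subseteq> A"
    and "\<And>A. A \<in> F \<Longrightarrow> finite A"
    and "\<And>A. A \<in> F \<Longrightarrow> c * card (T \<inter> A) \<le> card A"
  shows "c * card (T \<inter> \<Union>F) \<le> card (\<Union>F)"
proof -
  obtain D where D: "D \<subseteq> F" "disjoint D" "\<And>A. A \<in> F \<Longrightarrow> \<exists>B\<in>D. A \<subseteq> B"
    using laminar_disjoint_cover[of F] assms(1,2) by blast
  have "\<Union>D = \<Union>F" using D by blast
  moreover have "c * card (T \<inter> \<Union>D) \<le> card (\<Union>D)"
    using D assms by (intro disjoint_density) (auto intro: finite_subset)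
  ultimately show ?thesis by simp
qed

text \<open>The new slots are those of the \<open>4 m\<close>-th innermost jobs of \<open>G\<close> around the old ones. Jobs with
  small laxity compared to their share of \<open>T\<close> can make up only half of these \<open>4 m\<close> layers, by the
  load bound; so at least half of \<open>T\<close> lies within the other jobs, in which it is sparse.\<close>

lemma critical_expansion:
  assumes "finite J" "laminar_slots J" and load: "load_bounded m J" and "0 < m"
    and tight: "\<And>j. j \<in> J \<Longrightarrow> 8 * laxity j \<le> card (slots j)"
    and "G \<subseteq> J" "finite T"
    and cover: "\<And>t. t \<in> T \<Longrightarrow> n + 4 * m \<le> card {g \<in> G. t \<in> slots g}"
  obtains G' T' where "G' \<subseteq> G" "finite T'" "T \<subseteq> T'"
    "\<And>t. t \<in> T' \<Longrightarrow> n \<le> card {g \<in> G'. t \<in> slots g}"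
    "\<And>g. g \<in> G' \<Longrightarrow> 2 * card (T \<inter> slots g) \<le> card (T' \<inter> slots g)"
proof -
  have "finite G" using assms finite_subset by blast
  have laminar_G: "slots x \<subseteq> slots y \<or> slots y \<subseteq> slots x"
    if "x \<in> G" "y \<in> G" "slots x \<inter> slots y \<noteq> {}" for x y
    using that assms(2,6) unfolding laminar_slots_def by blast
  have key_G: "slots y \<subseteq> slots x"
    if "x \<in> G" "y \<in> G" "t \<in> slots x" "t \<in> slots y" "key x \<le> key y" for x y t
    using that assms(2,6) by (intro slots_subset_of_key[of J]) auto
  define C where "C t = {g \<in> G. t \<in> slots g}" for t
  \<comment> \<open>\<open>D t\<close> holds the \<open>4 * m\<close> innermost jobs of
    \<open>G\<close> around \<open>t\<close>; \<open>q t\<close> below is the outermost of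
    them.\<close>
  define D where "D t = top_set key (4 * m) (C t)" for t
  have C_fin: "finite (C t)" for t using \<open>finite G\<close> by (auto simp: C_def)
  have D_sub: "D t \<subseteq> C t" for t by (simp add: D_def top_set_subset)
  have D_fin: "finite (D t)" for t using C_fin D_sub finite_subset by blast
  have D_card: "card (D t) = 4 * m" if "t \<in> T" for t
    using cover[OF that] C_fin unfolding D_def by (subst card_top_set) (auto simp: inj_key C_def)
  have "\<exists>x\<in>D t. \<forall>g\<in>D t. key x \<le> key g" if "t \<in> T" for t
  proof -
    have ne: "D t \<noteq> {}" using D_card[OF that] \<open>0 < m\<close> by auto
    show ?thesis
      using arg_min_if_finite(1)[OF D_fin ne, of key] arg_min_least[OF D_fin ne, of _ key] by blast
  qed
  then obtain q where q: "\<And>t. t \<in> T \<Longrightarrow> q t \<in> D t"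
    and q_min: "\<And>t g. t \<in> T \<Longrightarrow> g \<in> D t \<Longrightarrow> key (q t) \<le> key g"
    by metis
  have q_G: "q t \<in> G" "t \<in> slots (q t)" if "t \<in> T" for t
    using q[OF that] D_sub[of t] by (auto simp: C_def)
  have inner: "slots g \<subseteq> slots (q t)" if "t \<in> T" "g \<in> D t" for t g
    using key_G[of "q t" g t] q_min[OF that] q_G[OF that(1)] that D_sub[of t] by (auto simp: C_def)
  have outer: "slots (q t) \<subseteq> slots g" if "t \<in> T" "g \<in> C t - D t" for t g
  proof -
    have "rank_in key (C t) (q t) < rank_in key (C t) g"
      using q[OF that(1)] that(2) by (auto simp: D_def top_set_def)
    then have "key g < key (q t)"
      using rank_less_iff[OF C_fin, of "q t" t g key] that q[OF that(1)] D_sub[of t] by auto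
    then show ?thesis
      using key_G[of g "q t" t] q_G[OF that(1)] that by (auto simp: C_def)
  qed
  have fin_img: "finite ((\<lambda>t. slots (q t)) ` T)" using \<open>finite T\<close> by simp
  \<comment> \<open>The maximal intervals among the \<open>slots (q t)\<close>; their disjoint union
    becomes \<open>T'\<close>.\<close>
  obtain Q where Q: "Q \<subseteq> (\<lambda>t. slots (q t)) ` T" "disjoint Q"
    and Q_cover: "\<And>A. A \<in> (\<lambda>t. slots (q t)) ` T \<Longrightarrow> \<exists>B\<in>Q. A \<subseteq> B"
  proof (rule laminar_disjoint_cover[OF fin_img])
    fix A B assume "A \<in> (\<lambda>t. slots (q t)) ` T" "B \<in> (\<lambda>t. slots (q t)) ` T" "A \<inter> B \<noteq> {}"
    then show "A \<subseteq> B \<or> B \<subseteq> A" using laminar_G q_G by auto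
  qed auto
  have Q_fin: "finite Q" using Q(1) fin_img finite_subset by blast
  have Q_fin': "finite A" if "A \<in> Q" for A using that Q(1) by auto
  have Q_eq: "A = B" if "A \<in> Q" "B \<in> Q" "t \<in> A" "t \<in> B" for A B t
    using Q(2) that by (auto simp: disjoint_def)
  have Q_inside: "slots (q t) \<subseteq> A" if "t \<in> T" "A \<in> Q" "t \<in> A" for t A
    using Q_cover[of "slots (q t)"] Q_eq[of A _ t] q_G(2) that by blast
  have dense: "2 * card (T \<inter> A) \<le> card A" if A: "A \<in> Q" for A
  proof -
    define H where "H = {g \<in> G. slots g \<subseteq> A}"
    \<comment> \<open>For jobs in \<open>Sat\<close>, the share of \<open>T\<close> is at least
      twice the laxity, so subtracting the laxity loses at most half of it.\<close>
    define Sat where "Sat = {g \<in> H. 2 * laxity g \<le> card (T \<inter> slots g)}"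
    define U where "U = \<Union>(slots ` (H - Sat))"
    have H_fin: "finite H" "finite Sat" using \<open>finite G\<close> by (auto simp: H_def Sat_def)
    have TA_fin: "finite (T \<inter> A)" "finite A" using \<open>finite T\<close> Q_fin'[OF A] by auto
    have D_H: "D t \<subseteq> H" if "t \<in> T \<inter> A" for t
      using inner[of t] Q_inside[of t A] that A D_sub[of t] unfolding H_def C_def by blast
    have D_slots: "t \<in> slots g" if "g \<in> D t" for t g
      using that D_sub[of t] by (auto simp: C_def)
    have sat: "(\<Sum>t\<in>T \<inter> A. card (D t \<inter> Sat)) \<le> 2 * m * card (T \<inter> A)"
    proof -
      have "(\<Sum>t\<in>T \<inter> A. card (D t \<inter> Sat)) \<le> (\<Sum>t\<in>T \<inter> A. card {g \<in> Sat. t \<in> slots g})"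
        using H_fin D_slots by (intro sum_mono card_mono) auto
      also have "\<dots> = (\<Sum>g\<in>Sat. card {t \<in> T \<inter> A. t \<in> slots g})"
        using TA_fin H_fin by (intro double_count) auto
      also have "\<dots> \<le> (\<Sum>g\<in>Sat. 2 * (card ((T \<inter> A) \<inter> slots g) - laxity g))"
      proof (rule sum_mono)
        fix g assume "g \<in> Sat"
        then have "(T \<inter> A) \<inter> slots g = T \<inter> slots g" "2 * laxity g \<le> card (T \<inter> slots g)"
          by (auto simp: Sat_def H_def)
        moreover have "{t \<in> T \<inter> A. t \<in> slots g} = (T \<inter> A) \<inter> slots g" by auto
        ultimately show "card {t \<in> T \<inter> A. t \<in> slots g} \<le> 2 * (card ((T \<inter> A) \<inter> slots g) - laxity g)"
          by simp
      qed
      also have "\<dots> \<le> 2 * (m * card (T \<inter> A))"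
        unfolding sum_distrib_left[symmetric]
        using load assms(1,6) TA_fin by (intro mult_left_mono load_boundedD) (auto simp: Sat_def H_def)
      finally show ?thesis by simp
    qed
    have unsat: "card (D t - Sat) \<le> (if t \<in> U then 4 * m else 0)" if t: "t \<in> T \<inter> A" for t
    proof (cases "t \<in> U")
      case True
      then show ?thesis
        using D_card[of t] t D_fin[of t] by (metis Diff_subset IntD1 card_mono)
    next
      case False
      then have "D t - Sat = {}" using D_H[OF t] D_slots[of _ t] by (auto simp: U_def)
      then show ?thesis by (metis card.empty le0)
    qed
    \<comment> \<open>Of the \<open>4 * m\<close> layers over \<open>T \<inter> A\<close>,
      \<open>Sat\<close> fills at most \<open>2 * m\<close> on average; the rest lies over
      \<open>T \<inter> U\<close>, so \<open>U\<close> contains at least half of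
      \<open>T \<inter> A\<close>.\<close>
    have "4 * m * card (T \<inter> A) = (\<Sum>t\<in>T \<inter> A. card (D t))"
      using D_card by simp
    also have "\<dots> = (\<Sum>t\<in>T \<inter> A. card (D t \<inter> Sat) + card (D t - Sat))"
      by (intro sum.cong refl) (metis D_fin card_Int_Diff)
    also have "\<dots> = (\<Sum>t\<in>T \<inter> A. card (D t \<inter> Sat)) + (\<Sum>t\<in>T \<inter> A. card (D t - Sat))"
      by (rule sum.distrib)
    also have "\<dots> \<le> 2 * m * card (T \<inter> A) + (\<Sum>t\<in>T \<inter> A. if t \<in> U then 4 * m else 0)"
      by (intro add_mono sat sum_mono unsat)
    also have "(\<Sum>t\<in>T \<inter> A. if t \<in> U then 4 * m else 0) = 4 * m * card (T \<inter> A \<inter> U)"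
      using TA_fin by (simp add: sum.If_cases Int_def)
    also have "T \<inter> A \<inter> U = T \<inter> U"
      by (auto simp: U_def H_def)
    finally have "m * (2 * card (T \<inter> A)) \<le> m * (4 * card (T \<inter> U))"
      by (simp add: algebra_simps)
    then have "2 * card (T \<inter> A) \<le> 4 * card (T \<inter> U)"
      using \<open>0 < m\<close> by simp
    also have "\<dots> \<le> card U"
      unfolding U_def
    proof (rule laminar_density)
      show "finite (slots ` (H - Sat))" using H_fin by simp
      fix A' assume "A' \<in> slots ` (H - Sat)"
      then obtain g where g: "A' = slots g" "g \<in> H" "g \<notin> Sat" by auto
      then show "finite A'" by simp
      \<comment> \<open>Here tightness enters: outside \<open>Sat\<close> the share is below
        \<open>2 * laxity g\<close>, which is at most a quarter of \<open>slots g\<close>.\<close>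
      have "card (T \<inter> slots g) < 2 * laxity g" "8 * laxity g \<le> card (slots g)"
        using g tight[of g] \<open>G \<subseteq> J\<close> by (auto simp: Sat_def H_def)
      then show "4 * card (T \<inter> A') \<le> card A'" using g by simp
    next
      fix A' B' assume "A' \<in> slots ` (H - Sat)" "B' \<in> slots ` (H - Sat)" "A' \<inter> B' \<noteq> {}"
      then show "A' \<subseteq> B' \<or> B' \<subseteq> A'" using laminar_G by (auto simp: H_def)
    qed
    also have "\<dots> \<le> card A"
      using TA_fin by (intro card_mono) (auto simp: U_def H_def)
    finally show ?thesis .
  qed
  define G' where "G' = {g \<in> G. \<exists>A\<in>Q. A \<subseteq> slots g}"
  show ?thesis
  proof
    show "G' \<subseteq> G" by (auto simp: G'_def)
    show "finite (\<Union>Q)" using Q_fin Q_fin' by auto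
    show "T \<subseteq> \<Union>Q" using Q_cover q_G(2) by blast
    show "n \<le> card {g \<in> G'. s \<in> slots g}" if s: "s \<in> \<Union>Q" for s
    proof -
      obtain t where t: "t \<in> T" "slots (q t) \<in> Q" "s \<in> slots (q t)" using s Q(1) by auto
      \<comment> \<open>Jobs around \<open>t\<close> beyond the \<open>4 * m\<close> innermost
        contain all of \<open>slots (q t)\<close>, hence also \<open>s\<close>.\<close>
      have "C t - D t \<subseteq> {g \<in> G'. s \<in> slots g}"
        using outer[OF t(1)] t by (auto simp: G'_def C_def)
      then have "card (C t - D t) \<le> card {g \<in> G'. s \<in> slots g}"
        using \<open>finite G\<close> by (intro card_mono) (auto simp: G'_def)
      moreover have "card (C t - D t) = card (C t) - 4 * m"
        using D_card[OF t(1)] D_sub D_fin by (simp add: card_Diff_subset)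
      ultimately show ?thesis
        using cover[OF t(1)] by (simp add: C_def)
    qed
    show "2 * card (T \<inter> slots g) \<le> card (\<Union>Q \<inter> slots g)" if g: "g \<in> G'" for g
    proof -
      define V where "V = {A \<in> Q. A \<subseteq> slots g}"
      obtain A where A: "A \<in> Q" "A \<subseteq> slots g" and "g \<in> G" using g by (auto simp: G'_def)
      have "T \<inter> slots g \<subseteq> T \<inter> \<Union>V"
      proof
        fix t assume t: "t \<in> T \<inter> slots g"
        then obtain B where B: "B \<in> Q" "t \<in> B" using Q_cover q_G(2) by blast
        then obtain t' where t': "t' \<in> T" "B = slots (q t')" using Q(1) by auto
        consider "B \<subseteq> slots g" | "slots g \<subseteq> B"
          using laminar_G[of "q t'" g] q_G(1)[OF t'(1)] \<open>g \<in> G\<close> t B t' by blast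
        then show "t \<in> T \<inter> \<Union>V"
        proof cases
          case 1
          then show ?thesis using B t by (auto simp: V_def)
        next
          case 2
          \<comment> \<open>Now \<open>A \<subseteq> slots g \<subseteq> B\<close>, and disjointness
            of \<open>Q\<close> leaves only \<open>A = B\<close>.\<close>
          obtain u where "u \<in> A" using A(1) Q(1) q_G(2) by blast
          then have "A = B" using Q_eq[OF A(1) B(1)] 2 A(2) by blast
          then show ?thesis using A B t by (auto simp: V_def)
        qed
      qed
      then have "2 * card (T \<inter> slots g) \<le> 2 * card (T \<inter> \<Union>V)"
        using \<open>finite T\<close> by (intro mult_left_mono card_mono) auto
      also have "\<dots> \<le> card (\<Union>V)"
        using Q(2) Q_fin Q_fin' dense by (intro disjoint_density) (auto simp: V_def disjoint_def)
      also have "\<dots> \<le> card (\<Union>Q \<inter> slots g)"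
        by (intro card_mono) (auto simp: V_def)
      finally show ?thesis .
    qed
  qed
qed

text \<open>Induction on the number \<open>n\<close> of remaining expansions: \<open>2 ^ a\<close>
  records how often the shares of \<open>T\<close> have doubled, and each expansion uses up
  \<open>4 * m\<close> layers. At \<open>n = 0\<close> the factor has reached \<open>2 * M\<close>,
  so every share is at least twice the laxity, and the load bound allows only \<open>2 * m\<close>
  of the remaining \<open>4 * m\<close> layers.\<close>

lemma no_critical_pair:
  assumes "finite J" "laminar_slots J" and load: "load_bounded m J" and "0 < m"
    and tight: "\<And>j. j \<in> J \<Longrightarrow> 8 * laxity j \<le> card (slots j)"
    and "0 < M" "2 * M \<le> 2 ^ (a + n)"
    and "G \<subseteq> J" "finite T"
    and "\<And>g. g \<in> G \<Longrightarrow> 2 ^ a * laxity g \<le> M * card (T \<inter> slots g)"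
    and "\<And>t. t \<in> T \<Longrightarrow> (n + 1) * (4 * m) \<le> card {g \<in> G. t \<in> slots g}"
  shows "T = {}"
  using assms(7-)
proof (induction n arbitrary: a G T)
  case 0
  have "finite G" using 0 assms(1) finite_subset by blast
  have "2 * laxity g \<le> card (T \<inter> slots g)" if "g \<in> G" for g
  proof -
    have "M * (2 * laxity g) \<le> 2 ^ a * laxity g" using 0(1) by simp
    also have "\<dots> \<le> M * card (T \<inter> slots g)" by (rule 0(4)[OF that])
    finally show ?thesis using \<open>0 < M\<close> by simp
  qed
  note sat = this
  have "4 * m * card T \<le> (\<Sum>t\<in>T. card {g \<in> G. t \<in> slots g})"
    using sum_mono[OF 0(5), of T "\<lambda>t. t"] by (simp add: mult.commute)
  also have "\<dots> = (\<Sum>g\<in>G. card {t \<in> T. t \<in> slots g})"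
    by (rule double_count) fact+
  also have "\<dots> \<le> (\<Sum>g\<in>G. 2 * (card (T \<inter> slots g) - laxity g))"
  proof (rule sum_mono)
    fix g assume "g \<in> G"
    moreover have "{t \<in> T. t \<in> slots g} = T \<inter> slots g" by auto
    ultimately show "card {t \<in> T. t \<in> slots g} \<le> 2 * (card (T \<inter> slots g) - laxity g)"
      using sat[of g] by simp
  qed
  also have "\<dots> \<le> 2 * (m * card T)"
    unfolding sum_distrib_left[symmetric]
    using load assms(1) 0 by (intro mult_left_mono load_boundedD) auto
  finally have "card T = 0" using \<open>0 < m\<close> by simp
  then show ?case using 0 by simp
next
  case (Suc n)
  have cover: "(n + 1) * (4 * m) + 4 * m \<le> card {g \<in> G. t \<in> slots g}" if "t \<in> T" for t
    using Suc.prems(5)[OF that] by simp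
  obtain G' T' where *: "G' \<subseteq> G" "finite T'" "T \<subseteq> T'"
    "\<And>t. t \<in> T' \<Longrightarrow> (n + 1) * (4 * m) \<le> card {g \<in> G'. t \<in> slots g}"
    and double: "\<And>g. g \<in> G' \<Longrightarrow> 2 * card (T \<inter> slots g) \<le> card (T' \<inter> slots g)"
    by (rule critical_expansion[of J m G T "(n + 1) * (4 * m)"])
      (use assms(1-5) Suc.prems(2,3) cover in \<open>blast+\<close>)
  have "T' = {}"
  proof (rule Suc.IH[of "Suc a"])
    show "2 * M \<le> 2 ^ (Suc a + n)" using Suc.prems(1) by simp
    show "G' \<subseteq> J" using * Suc.prems by blast
    show "2 ^ Suc a * laxity g \<le> M * card (T' \<inter> slots g)" if "g \<in> G'" for g
    proof -
      have "2 ^ Suc a * laxity g \<le> 2 * (M * card (T \<inter> slots g))"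
        using Suc.prems(4)[of g] that *(1) by auto
      also have "\<dots> \<le> M * card (T' \<inter> slots g)"
        using mult_left_mono[OF double[OF that], of M] by (simp add: mult.left_commute)
      finally show ?thesis .
    qed
  qed (use * in auto)
  then show ?case using * by blast
qed

section \<open>Tight jobs\<close>

definition surviving :: "(job \<Rightarrow> job option) \<Rightarrow> job set \<Rightarrow> job set" where
  "surviving v B = {c \<in> B. \<forall>y\<in>B. v y \<noteq> Some c}"

text \<open>The strict \<open>key\<close> comparison also orders jobs with equal intervals, so
  arrivals are handled one by one.\<close>

definition containing :: "job set \<Rightarrow> job \<Rightarrow> job set" where
  "containing J x = {y \<in> J. key y < key x \<and> slots x \<subseteq> slots y}"

text \<open>A job \<open>x\<close> suspends its victim \<open>v x\<close> during the whole interval of \<open>x\<close>. The jobs that are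
  running when \<open>x\<close> arrives are the candidates for becoming its victim.\<close>

definition candidates :: "job set \<Rightarrow> (job \<Rightarrow> job option) \<Rightarrow> job \<Rightarrow> job set" where
  "candidates J v x = surviving v (containing J x)"

text \<open>\<open>rank_in\<close> counts larger keys, so rank 0 is the innermost candidate.\<close>

definition victim_rank :: "job set \<Rightarrow> (job \<Rightarrow> job option) \<Rightarrow> job \<Rightarrow> job \<Rightarrow> nat" where
  "victim_rank J v x = rank_in key (candidates J v x)"

definition charges :: "job set \<Rightarrow> (job \<Rightarrow> job option) \<Rightarrow> job \<Rightarrow> nat \<Rightarrow> job set" where
  "charges J v c i = {y \<in> J. v y = Some c \<and> victim_rank J v y c = i}"

text \<open>The laxity of a job is split into \<open>M\<close> equal budgets, one for each rank it can have among the
  candidates.\<close>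

definition affordable :: "nat \<Rightarrow> job set \<Rightarrow> (job \<Rightarrow> job option) \<Rightarrow> job \<Rightarrow> job \<Rightarrow> bool" where
  "affordable M J v x c \<longleftrightarrow> c \<in> candidates J v x \<and>
     M * ((\<Sum>y\<in>{y \<in> charges J v c (victim_rank J v x c). key y < key x}. card (slots y))
       + card (slots x)) \<le> laxity c"

text \<open>When all \<open>M\<close> places are taken, the innermost affordable candidate is
  suspended. The second way to obtain \<open>None\<close> keeps the rule satisfiable in every state;
  \<open>affordable_candidate_exists\<close> excludes it for suitable \<open>M\<close>.\<close>

definition victim_rule :: "nat \<Rightarrow> job set \<Rightarrow> (job \<Rightarrow> job option) \<Rightarrow> job \<Rightarrow> job option \<Rightarrow> bool" where
  "victim_rule M J v x r \<longleftrightarrow> (case r of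
     None \<Rightarrow> card (candidates J v x) < M \<or> (\<forall>c. \<not> affordable M J v x c)
   | Some c \<Rightarrow> M \<le> card (candidates J v x) \<and> affordable M J v x c \<and>
       (\<forall>c'. affordable M J v x c' \<longrightarrow> key c' \<le> key c))"

definition is_victim_map :: "nat \<Rightarrow> job set \<Rightarrow> (job \<Rightarrow> job option) \<Rightarrow> bool" where
  "is_victim_map M J v \<longleftrightarrow> (\<forall>x\<in>J. victim_rule M J v x (v x))"

text \<open>The choice by \<open>SOME\<close> is harmless: \<open>is_victim_map_unique\<close> fixes
  the values on \<open>J\<close>, consistently with those computed from the jobs known
  earlier.\<close>

definition victims :: "nat \<Rightarrow> job set \<Rightarrow> job \<Rightarrow> job option" where
  "victims M J = (SOME v. is_victim_map M J v)"

definition tight_run :: "nat \<Rightarrow> job set \<Rightarrow> nat \<Rightarrow> job set" where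
  "tight_run M J t = surviving (victims M J) {j \<in> J. t \<in> slots j}"

section \<open>Causality of the victim choice\<close>

definition agree_before ::
    "job set \<Rightarrow> (job \<Rightarrow> job option) \<Rightarrow> job set \<Rightarrow> (job \<Rightarrow> job option) \<Rightarrow> job \<Rightarrow> bool" where
  "agree_before J v J' v' x \<longleftrightarrow>
     (\<forall>y. key y < key x \<longrightarrow> (y \<in> J \<longleftrightarrow> y \<in> J') \<and> (y \<in> J \<longrightarrow> v y = v' y))"

lemma candidates_cong:
  assumes "agree_before J v J' v' x"
  shows "candidates J v x = candidates J' v' x"
proof -
  have "containing J x = containing J' x" "\<And>y. y \<in> containing J x \<Longrightarrow> v y = v' y"
    using assms unfolding agree_before_def containing_def by blast+
  then show ?thesis
    unfolding candidates_def surviving_def by auto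
qed

text \<open>Candidates, ranks and earlier charges seen by \<open>x\<close> all stem from jobs of
  smaller key.\<close>

lemma victim_rule_cong:
  assumes "agree_before J v J' v' x"
  shows "victim_rule M J v x = victim_rule M J' v' x"
proof -
  have "agree_before J v J' v' y" if "key y < key x" for y
    using assms that unfolding agree_before_def by (meson less_trans)
  then have "victim_rank J v y = victim_rank J' v' y" if "key y < key x \<or> y = x" for y
    using that assms candidates_cong unfolding victim_rank_def by metis
  then have rank: "victim_rank J v x = victim_rank J' v' x"
      "\<And>y. key y < key x \<Longrightarrow> victim_rank J v y = victim_rank J' v' y"
    by auto
  have "{y \<in> charges J v c i. key y < key x} = {y \<in> charges J' v' c i. key y < key x}" for c i
    using assms rank(2) unfolding charges_def agree_before_def by auto
  then have *: "affordable M J v x = affordable M J' v' x"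
    unfolding affordable_def rank candidates_cong[OF assms] by simp
  show ?thesis
    unfolding victim_rule_def candidates_cong[OF assms] * ..
qed

lemma finite_candidates [simp]: "finite J \<Longrightarrow> finite (candidates J v x)"
  by (simp add: candidates_def surviving_def containing_def)

lemma candidatesD:
  assumes "c \<in> candidates J v x"
  shows "c \<in> J" "key c < key x" "slots x \<subseteq> slots c"
    "\<And>y. y \<in> J \<Longrightarrow> key y < key x \<Longrightarrow> slots x \<subseteq> slots y \<Longrightarrow> v y \<noteq> Some c"
  using assms by (auto simp: candidates_def surviving_def containing_def)

lemma finite_max_key:
  assumes "finite B" "B \<noteq> {}"
  shows "\<exists>x\<in>B. \<forall>y\<in>B. key y \<le> key x"
proof -
  have "Max (key ` B) \<in> key ` B" using assms by (intro Max_in) auto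
  then obtain x where "x \<in> B" "key x = Max (key ` B)" by auto
  then show ?thesis using assms(1) by (auto intro!: bexI[of _ x])
qed

lemma victim_rule_exists:
  assumes "finite J"
  shows "\<exists>r. victim_rule M J v x r"
proof (cases "card (candidates J v x) < M \<or> (\<forall>c. \<not> affordable M J v x c)")
  case True
  then have "victim_rule M J v x None" by (simp add: victim_rule_def)
  then show ?thesis ..
next
  case False
  let ?A = "{c. affordable M J v x c}"
  have "finite ?A"
    by (rule finite_subset[OF _ finite_candidates[OF assms]]) (auto simp: affordable_def)
  then obtain c where "c \<in> ?A" "\<forall>c'\<in>?A. key c' \<le> key c"
    using False by (metis (mono_tags, lifting) empty_Collect_eq finite_max_key)
  then have "victim_rule M J v x (Some c)"
    using False by (auto simp: victim_rule_def)
  then show ?thesis ..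
qed

lemma victim_rule_unique:
  assumes "victim_rule M J v x r" "victim_rule M J v x r'"
  shows "r = r'"
proof (cases r)
  case None
  then show ?thesis using assms by (cases r') (auto simp: victim_rule_def)
next
  case (Some c)
  then obtain c' where c': "r' = Some c'" using assms by (cases r') (auto simp: victim_rule_def)
  then have "key c \<le> key c'" "key c' \<le> key c"
    using assms Some by (auto simp: victim_rule_def)
  then have "key c = key c'" by (rule antisym)
  then show ?thesis using Some c' by simp
qed

text \<open>Jobs are inserted by increasing key; the value chosen for the last one leaves the rule
  for the earlier ones intact.\<close>

lemma is_victim_map_exists:
  assumes "finite J"
  shows "\<exists>v. is_victim_map M J v"
  using assms
proof (induction J rule: finite_ranking_induct[where f = key])
  case empty
  then show ?case by (simp add: is_victim_map_def)
next
  case (insert x S)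
  then obtain v where v: "is_victim_map M S v" by auto
  show ?case
  proof (cases "x \<in> S")
    case True
    then show ?thesis using v by (auto simp: insert_absorb)
  next
    case False
    then have last: "key y < key x" if "y \<in> S" for y
      using insert.hyps(2)[OF that] that by (metis key_eq_iff order_le_less)
    obtain r where r: "victim_rule M (insert x S) v x r"
      using victim_rule_exists[of "insert x S" M v x] insert.hyps(1) by blast
    have "agree_before (insert x S) (v(x := r)) S v y" if "y \<in> S" for y
      using last[OF that] False by (auto simp: agree_before_def)
    moreover have "agree_before (insert x S) (v(x := r)) (insert x S) v x"
      by (auto simp: agree_before_def)
    ultimately have "is_victim_map M (insert x S) (v(x := r))"
      using r v False unfolding is_victim_map_def
      by (metis fun_upd_apply insertE victim_rule_cong)
    then show ?thesis by (rule exI[where x = "v(x := r)"])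
  qed
qed

lemma victims_is_victim_map: "finite J \<Longrightarrow> is_victim_map M J (victims M J)"
  unfolding victims_def by (rule someI_ex[OF is_victim_map_exists])

text \<open>Induction along \<open>key\<close>: \<open>J'\<close> is an initial segment of
  \<open>J\<close>, so the rule at \<open>x\<close> sees the same earlier jobs and has only one
  solution.\<close>

lemma is_victim_map_unique:
  assumes "finite J" "is_victim_map M J v" "is_victim_map M J' v'"
    and "J' \<subseteq> J" and closed: "\<And>x y. x \<in> J' \<Longrightarrow> y \<in> J \<Longrightarrow> key y < key x \<Longrightarrow> y \<in> J'"
    and "x \<in> J'"
  shows "v x = v' x"
proof (rule finite_ranked_induct[where f = key and X = J'])
  show "finite J'" using assms finite_subset by blast
  fix x assume x: "x \<in> J'" "\<And>y. y \<in> J' \<Longrightarrow> key y < key x \<Longrightarrow> v y = v' y"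
  then have "agree_before J v J' v' x"
    using closed[OF x(1)] \<open>J' \<subseteq> J\<close> by (auto simp: agree_before_def)
  then have "victim_rule M J' v' x (v x)"
    using assms(2,4) x(1) unfolding is_victim_map_def by (metis subsetD victim_rule_cong)
  then show "v x = v' x"
    using assms(3) x(1) victim_rule_unique by (auto simp: is_victim_map_def)
qed fact

lemma tight_run_subset: "tight_run M J t \<subseteq> {j \<in> J. t \<in> slots j}"
  by (auto simp: tight_run_def surviving_def)

lemma tight_run_released_by:
  assumes "finite J"
  shows "tight_run M (released_by J t) t = tight_run M J t"
proof -
  let ?J = "released_by J t"
  have "victims M J x = victims M ?J x" if "x \<in> ?J" for x
  proof (rule is_victim_map_unique[OF assms _ _ _ _ that])
    show "is_victim_map M J (victims M J)" "is_victim_map M ?J (victims M ?J)"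
      using assms by (auto intro!: victims_is_victim_map simp: released_by_def)
    \<comment> \<open>\<open>key\<close> begins with the release date, so the released jobs form an
      initial segment.\<close>
    show "y \<in> ?J" if "x \<in> ?J" "y \<in> J" "key y < key x" for x y
      using that by (auto simp: released_by_def key_def)
  qed (auto simp: released_by_def)
  moreover have "{j \<in> ?J. t \<in> slots j} = {j \<in> J. t \<in> slots j}"
    by (auto simp: released_by_def slots_def)
  ultimately show ?thesis
    by (auto simp: tight_run_def surviving_def released_by_def slots_def)
qed

text \<open>The inverse of \<open>victim_rank\<close>, meaningful only for \<open>k\<close> below
  the number of candidates.\<close>

definition candidate :: "job set \<Rightarrow> (job \<Rightarrow> job option) \<Rightarrow> job \<Rightarrow> nat \<Rightarrow> job" where
  "candidate J v x = inv_into (candidates J v x) (victim_rank J v x)"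

text \<open>Step case: the jobs \<open>y\<close> charged to the exhausted budget of rank \<open>i\<close> of \<open>h i\<close>. As \<open>y\<close> charges
  the affordable candidate of smallest rank, its candidates of rank below \<open>i\<close> had exhausted budgets
  as well, while the members \<open>h k\<close> with \<open>k > i\<close> still contain \<open>y\<close>.\<close>

inductive exhausted_chain ::
    "nat \<Rightarrow> job set \<Rightarrow> (job \<Rightarrow> job option) \<Rightarrow> job \<Rightarrow> job \<Rightarrow> (nat \<Rightarrow> job) \<Rightarrow> bool"
  for M J v x0 where
  start: "exhausted_chain M J v x0 x0 (candidate J v x0)"
| step: "exhausted_chain M J v x0 y (\<lambda>k. if k < i then candidate J v y k else h k)"
    if "exhausted_chain M J v x0 x h" "i < M" "y \<in> charges J v (h i) i"

lemma candidate:
  assumes "finite J" "k < card (candidates J v x)"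
  shows "candidate J v x k \<in> candidates J v x" "victim_rank J v x (candidate J v x k) = k"
proof -
  have "bij_betw (victim_rank J v x) (candidates J v x) {..<card (candidates J v x)}"
    unfolding victim_rank_def using assms(1) by (intro bij_betw_rank) (auto simp: inj_key)
  then show "candidate J v x k \<in> candidates J v x" "victim_rank J v x (candidate J v x k) = k"
    using assms(2) unfolding candidate_def bij_betw_def
    by (metis inv_into_into lessThan_iff, metis f_inv_into_f lessThan_iff)
qed

section \<open>Sufficiency of the budgets for tight jobs\<close>

context
  fixes M m L :: nat and J :: "job set" and v :: "job \<Rightarrow> job option"
  assumes fin: "finite J" and lam: "laminar_slots J" and load: "load_bounded m J"
    and nonempty: "\<And>j. j \<in> J \<Longrightarrow> slots j \<noteq> {}"
    and tight: "\<And>j. j \<in> J \<Longrightarrow> 8 * laxity j \<le> card (slots j)"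
    and m_pos: "0 < m"
    and M_large: "(L + 1) * (4 * m) \<le> M" "2 * M \<le> 2 ^ L"
    and v: "is_victim_map M J v"
begin

lemma M_pos: "0 < M"
  using M_large(1) m_pos by (cases M) auto

lemma victim_Some:
  assumes "y \<in> J" "v y = Some c"
  shows "M \<le> card (candidates J v y)" "affordable M J v y c" "c \<in> candidates J v y"
    "\<And>c'. affordable M J v y c' \<Longrightarrow> key c' \<le> key c"
  using v assms by (auto simp: is_victim_map_def victim_rule_def affordable_def split: option.splits)

lemma slots_subset_key:
  "x \<in> J \<Longrightarrow> y \<in> J \<Longrightarrow> t \<in> slots x \<Longrightarrow> t \<in> slots y \<Longrightarrow> key x \<le> key y \<Longrightarrow> slots y \<subseteq> slots x"
  using slots_subset_of_key[OF lam] by blast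

text \<open>Otherwise \<open>y\<close> would contain \<open>z\<close>, and \<open>c\<close>, already
  suspended by \<open>y\<close>, could not be a candidate for \<open>z\<close>.\<close>

lemma charged_disjoint:
  assumes "y \<in> J" "v y = Some c" "z \<in> J" "c \<in> candidates J v z" "key y < key z"
  shows "slots y \<inter> slots z = {}"
proof (rule ccontr)
  assume "slots y \<inter> slots z \<noteq> {}"
  then have "slots z \<subseteq> slots y" using slots_subset_key assms by (meson disjoint_iff less_imp_le)
  then show False using candidatesD(4)[OF assms(4,1)] assms by blast
qed

text \<open>The invariant of the chain: \<open>h 0, ..., h (M - 1)\<close> are nested from the
  inside out around \<open>x\<close>, and each \<open>h i\<close> is an unaffordable candidate of
  rank \<open>i\<close> for some job \<open>z\<close> of the chain.\<close>

lemma exhausted_chain_props: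
  assumes x0: "x0 \<in> J" and full: "M \<le> card (candidates J v x0)"
    and fail: "\<And>c. \<not> affordable M J v x0 c"
    and "exhausted_chain M J v x0 x h"
  shows "x \<in> J \<and>
    (\<forall>i<M. h i \<in> J \<and> slots x \<subseteq> slots (h i) \<and> (\<forall>k<i. key (h i) < key (h k)) \<and>
      (\<exists>z h'. exhausted_chain M J v x0 z h' \<and> z \<in> J \<and> h' i = h i \<and> h i \<in> candidates J v z \<and>
         victim_rank J v z (h i) = i \<and> \<not> affordable M J v z (h i)))"
  using assms(4)
proof (induction rule: exhausted_chain.induct)
  case start
  have cand: "candidate J v x0 i \<in> candidates J v x0" "victim_rank J v x0 (candidate J v x0 i) = i"
    if "i < M" for i
    using candidate[OF fin] that full by (meson less_le_trans)+
  have "key (candidate J v x0 i) < key (candidate J v x0 k)" if "i < M" "k < i" for i k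
  proof (subst rank_less_iff[of "candidates J v x0", symmetric])
    show "rank_in key (candidates J v x0) (candidate J v x0 k) < rank_in key (candidates J v x0) (candidate J v x0 i)"
      using cand[of i] cand[of k] that by (simp add: victim_rank_def)
  qed (use cand that fin in auto)
  then show ?case
    using x0 cand candidatesD fail exhausted_chain.start by metis
next
  case (step x h i y)
  let ?h = "\<lambda>k. if k < i then candidate J v y k else h k"
  have y: "y \<in> J" "v y = Some (h i)" "victim_rank J v y (h i) = i"
    using step.hyps by (auto simp: charges_def)
  note vic = victim_Some[OF y(1,2)]
  have chain: "exhausted_chain M J v x0 y ?h"
    using step.hyps by (rule exhausted_chain.step)
  have cand: "candidate J v y k \<in> candidates J v y" "victim_rank J v y (candidate J v y k) = k"
    if "k < M" for k
    using candidate[OF fin] that vic(1) by (meson less_le_trans)+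
  have key_lt: "key c < key c'"
    if "c \<in> candidates J v y" "c' \<in> candidates J v y" "victim_rank J v y c' < victim_rank J v y c" for c c'
    using that rank_less_iff[of "candidates J v y" c' c key] fin by (simp add: victim_rank_def)
  have outer: "slots (h i) \<subseteq> slots (h k)" "key (h k) \<le> key (h i)" if "k < M" "i \<le> k" for k
  proof -
    show key: "key (h k) \<le> key (h i)" using step.IH that by (metis less_imp_le order_le_less)
    obtain t where "t \<in> slots x" using step.IH nonempty by blast
    then show "slots (h i) \<subseteq> slots (h k)"
      using step.IH that \<open>i < M\<close> key slots_subset_key[of "h k" "h i" t] by blast
  qed
  have "?h k \<in> J \<and> slots y \<subseteq> slots (?h k) \<and> (\<forall>l<k. key (?h k) < key (?h l)) \<and>
      (\<exists>z h'. exhausted_chain M J v x0 z h' \<and> z \<in> J \<and> h' k = ?h k \<and> ?h k \<in> candidates J v z \<and>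
         victim_rank J v z (?h k) = k \<and> \<not> affordable M J v z (?h k))" if "k < M" for k
  proof (cases "k < i")
    case True
    have lt: "key (h i) < key (candidate J v y k)"
      using key_lt[OF vic(3) cand(1)] cand(2) \<open>k < M\<close> y(3) True by simp
    then have "\<not> affordable M J v y (candidate J v y k)"
      using vic(4) by (meson not_le)
    moreover have "key (candidate J v y k) < key (?h l)" if "l < k" for l
      using key_lt[OF cand(1) cand(1)] cand(2) \<open>k < M\<close> True that by simp
    ultimately show ?thesis
      using cand[OF \<open>k < M\<close>] True chain y(1) candidatesD(1,3)[OF cand(1)[OF \<open>k < M\<close>]]
      by (intro conjI exI[of _ y] exI[of _ ?h]) auto
  next
    case False
    have "key (h k) < key (?h l)" if "l < k" for l
    proof (cases "l < i")
      case True
      then have "key (h i) < key (candidate J v y l)"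
        using key_lt[OF vic(3) cand(1)] cand(2) \<open>i < M\<close> y(3) by simp
      then show ?thesis using outer(2)[of k] \<open>k < M\<close> False True by simp
    next
      case False
      then show ?thesis using step.IH \<open>k < M\<close> that by simp
    qed
    moreover have "slots y \<subseteq> slots (h k)"
      using candidatesD(3)[OF vic(3)] outer(1)[of k] False \<open>k < M\<close> by auto
    ultimately show ?thesis
      using step.IH \<open>k < M\<close> False by simp
  qed
  then show ?case using y(1) by blast
qed

text \<open>Unaffordability says that \<open>z\<close> and the jobs charged to this budget before it
  have total length more than \<open>laxity c / M\<close>; being disjoint and inside both
  \<open>c\<close> and \<open>T\<close>, they all count toward
  \<open>T \<inter> slots c\<close>.\<close>

lemma exhausted_budget:
  assumes "z \<in> J" "c \<in> candidates J v z" "\<not> affordable M J v z c"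
    and "slots z \<subseteq> T" "\<And>y. y \<in> charges J v c (victim_rank J v z c) \<Longrightarrow> slots y \<subseteq> T"
  shows "laxity c \<le> M * card (T \<inter> slots c)"
proof -
  define Y where "Y = {y \<in> charges J v c (victim_rank J v z c). key y < key z}"
  have Y: "y \<in> J" "v y = Some c" "key y < key z" "c \<in> candidates J v y" "slots y \<subseteq> T" if "y \<in> Y" for y
    using that victim_Some(3)[of y c] assms(5) by (auto simp: Y_def charges_def)
  have "finite Y" using fin by (auto simp: Y_def charges_def)
  have "laxity c < M * ((\<Sum>y\<in>Y. card (slots y)) + card (slots z))"
    using assms(2,3) by (simp add: affordable_def Y_def)
  also have "(\<Sum>y\<in>Y. card (slots y)) + card (slots z) = (\<Sum>y\<in>insert z Y. card (slots y))"
    using Y(3) \<open>finite Y\<close> by (subst sum.insert) auto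
  also have "\<dots> = card (\<Union>y\<in>insert z Y. slots y)"
  proof (rule card_UN_disjoint[symmetric])
    show "\<forall>x\<in>insert z Y. \<forall>y\<in>insert z Y. x \<noteq> y \<longrightarrow> slots x \<inter> slots y = {}"
    proof (intro ballI impI)
      fix x y assume xy: "x \<in> insert z Y" "y \<in> insert z Y" "x \<noteq> y"
      have *: "slots x \<inter> slots y = {}"
        if "x \<in> insert z Y" "y \<in> insert z Y" "key x < key y" for x y
      proof (rule charged_disjoint[of _ c])
        show "x \<in> J" "v x = Some c" using that Y(1,2,3) by (auto dest: less_asym)
        show "y \<in> J" "c \<in> candidates J v y" using that Y(1,4) assms(1,2) by auto
      qed fact
      show "slots x \<inter> slots y = {}"
        using *[OF xy(1,2)] *[OF xy(2,1)] xy(3) by (metis Int_commute key_eq_iff neqE)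
    qed
  qed (use \<open>finite Y\<close> in auto)
  also have "\<dots> \<le> card (T \<inter> slots c)"
    using Y(4,5) assms(2,4) by (intro card_mono) (auto dest: candidatesD(3))
  finally show ?thesis by simp
qed

text \<open>Otherwise the slots of all chain jobs and all members \<open>h i\<close> meet the
  assumptions of \<open>no_critical_pair\<close> with \<open>a = 0\<close> and \<open>n = L\<close>:
  the \<open>step\<close> rule puts every charged interval into \<open>T\<close>.\<close>

lemma affordable_candidate_exists:
  assumes x0: "x0 \<in> J" and full: "M \<le> card (candidates J v x0)"
  shows "\<exists>c. affordable M J v x0 c"
proof (rule ccontr)
  assume "\<not> ?thesis"
  then have fail: "\<And>c. \<not> affordable M J v x0 c" by blast
  let ?E = "exhausted_chain M J v x0"
  note props = exhausted_chain_props[OF x0 full fail]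
  define T where "T = \<Union>{slots x |x h. ?E x h}"
  define G where "G = (\<Union>(x, h)\<in>{(x, h). ?E x h}. h ` {..<M})"
  have "T \<subseteq> \<Union>(slots ` J)" using props by (auto simp: T_def)
  then have "finite T" by (rule finite_subset) (use fin in auto)
  have "G \<subseteq> J" using props by (auto simp: G_def)
  have "T = {}"
  proof (rule no_critical_pair[OF fin lam load m_pos tight M_pos])
    show "2 * M \<le> 2 ^ (0 + L)" using M_large by simp
    show "2 ^ 0 * laxity g \<le> M * card (T \<inter> slots g)" if g: "g \<in> G" for g
    proof -
      obtain x h i where "?E x h" "i < M" "g = h i" using g by (auto simp: G_def)
      then obtain z h' where z: "?E z h'" "z \<in> J" "h' i = g" "g \<in> candidates J v z"
          "victim_rank J v z g = i" "\<not> affordable M J v z g"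
        using props[of x h] by blast
      have "laxity g \<le> M * card (T \<inter> slots g)"
      proof (rule exhausted_budget[OF z(2,4,6)])
        show "slots z \<subseteq> T" using z(1) by (auto simp: T_def)
        fix y assume "y \<in> charges J v g (victim_rank J v z g)"
        then have "?E y (\<lambda>k. if k < i then candidate J v y k else h' k)"
          using z \<open>i < M\<close> by (intro exhausted_chain.step[of M J v x0 z h' i y]) auto
        then show "slots y \<subseteq> T" unfolding T_def by blast
      qed
      then show ?thesis by simp
    qed
    show "(L + 1) * (4 * m) \<le> card {g \<in> G. t \<in> slots g}" if t: "t \<in> T" for t
    proof -
      obtain x h where x: "?E x h" "t \<in> slots x" using t by (auto simp: T_def)
      have "inj_on h {..<M}"
        using props[OF x(1)] by (intro inj_onI) (metis lessThan_iff less_irrefl nat_neq_iff)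
      then have "M = card (h ` {..<M})" by (simp add: card_image)
      also have "\<dots> \<le> card {g \<in> G. t \<in> slots g}"
      proof (rule card_mono)
        show "finite {g \<in> G. t \<in> slots g}" using \<open>G \<subseteq> J\<close> fin finite_subset by fastforce
        show "h ` {..<M} \<subseteq> {g \<in> G. t \<in> slots g}"
          using props[OF x(1)] x by (auto simp: G_def)
      qed
      finally show ?thesis using M_large by simp
    qed
  qed (use \<open>finite T\<close> \<open>G \<subseteq> J\<close> in auto)
  moreover have "slots x0 \<subseteq> T"
    unfolding T_def using exhausted_chain.start[of M J v x0] by blast
  ultimately show False using nonempty[OF x0] by blast
qed

text \<open>Jobs sharing slot \<open>s\<close> are nested, so the one of largest key, the last
  arrival, lies inside all others. This reduces a count at a slot to the moment of that
  arrival.\<close>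

lemma containing_last:
  assumes "B \<subseteq> J" "B \<noteq> {}" "s \<in> \<Inter>(slots ` B)"
    and closed: "\<And>x y. x \<in> B \<Longrightarrow> y \<in> J \<Longrightarrow> key y < key x \<Longrightarrow> slots x \<subseteq> slots y \<Longrightarrow> y \<in> B"
  obtains x where "x \<in> B" "B = insert x (containing J x)"
proof -
  have "finite B" using assms(1) fin finite_subset by blast
  then obtain x where x: "x \<in> B" "\<forall>y\<in>B. key y \<le> key x"
    using assms(2) finite_max_key by metis
  have "B = insert x (containing J x)"
  proof (intro equalityI subsetI)
    fix y assume y: "y \<in> B"
    then show "y \<in> insert x (containing J x)"
      using x assms(1,3) slots_subset_key[of y x s] by (auto simp: containing_def order_le_less)
  next
    fix y assume "y \<in> insert x (containing J x)"
    then show "y \<in> B" using x closed by (auto simp: containing_def)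
  qed
  with x that show ?thesis by blast
qed

text \<open>With \<open>M\<close> candidates present an affordable one exists, and the arrival
  replaces its victim; otherwise there is room for one more.\<close>

lemma card_surviving_insert:
  assumes "x \<in> J" "card (candidates J v x) \<le> M"
  shows "card (surviving v (insert x (containing J x))) \<le> M"
proof (cases "v x")
  case None
  then have less: "card (candidates J v x) < M"
    using v assms(1) affordable_candidate_exists[OF assms(1)]
    by (fastforce simp: is_victim_map_def victim_rule_def split: option.splits)
  have "surviving v (insert x (containing J x)) \<subseteq> insert x (candidates J v x)"
    by (auto simp: surviving_def candidates_def)
  then have "card (surviving v (insert x (containing J x))) \<le> card (insert x (candidates J v x))"
    using fin by (intro card_mono) auto
  also have "\<dots> \<le> Suc (card (candidates J v x))" by (simp add: card_insert_if fin)
  finally show ?thesis using less by simp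
next
  case (Some c)
  note c = victim_Some(3)[OF assms(1) Some]
  have "surviving v (insert x (containing J x)) \<subseteq> insert x (candidates J v x - {c})"
    using Some by (auto simp: surviving_def candidates_def)
  then have "card (surviving v (insert x (containing J x))) \<le> card (insert x (candidates J v x - {c}))"
    using fin by (intro card_mono) auto
  also have "\<dots> \<le> Suc (card (candidates J v x - {c}))" by (simp add: card_insert_if fin)
  also have "\<dots> = card (candidates J v x)" using c fin by (intro card_Suc_Diff1) auto
  finally show ?thesis using assms(2) by simp
qed

text \<open>The candidates of \<open>x\<close> are the survivors just after the last arrival among
  the jobs containing \<open>x\<close>, to which the induction hypothesis applies.\<close>

lemma card_candidates_le:
  assumes "x \<in> J"
  shows "card (candidates J v x) \<le> M"
proof (rule finite_ranked_induct[where f = key, OF fin assms])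
  fix x assume x: "x \<in> J" "\<And>y. y \<in> J \<Longrightarrow> key y < key x \<Longrightarrow> card (candidates J v y) \<le> M"
  obtain s where s: "s \<in> slots x" using nonempty[OF x(1)] by blast
  show "card (candidates J v x) \<le> M"
  proof (cases "containing J x = {}")
    case True
    then show ?thesis by (simp add: candidates_def surviving_def)
  next
    case False
    obtain y where y: "y \<in> containing J x" "containing J x = insert y (containing J y)"
    proof (rule containing_last[of "containing J x" s])
      show "s \<in> \<Inter>(slots ` containing J x)" using s by (auto simp: containing_def)
    qed (use False in \<open>auto simp: containing_def dest: less_trans\<close>)
    have y_J: "y \<in> J" "key y < key x" using y(1) by (auto simp: containing_def)
    have "card (surviving v (insert y (containing J y))) \<le> M"
      using y_J x(2) by (intro card_surviving_insert)
    then show ?thesis unfolding candidates_def y(2) .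
  qed
qed

lemma card_surviving_le: "card (surviving v {j \<in> J. t \<in> slots j}) \<le> M"
proof (cases "{j \<in> J. t \<in> slots j} = {}")
  case True
  show ?thesis unfolding True by (simp add: surviving_def)
next
  case False
  obtain y where y: "y \<in> {j \<in> J. t \<in> slots j}" "{j \<in> J. t \<in> slots j} = insert y (containing J y)"
    by (rule containing_last[of "{j \<in> J. t \<in> slots j}" t]) (use False in auto)
  have "y \<in> J" using y(1) by simp
  then have "card (surviving v (insert y (containing J y))) \<le> M"
    by (intro card_surviving_insert card_candidates_le)
  then show ?thesis unfolding y(2) .
qed

text \<open>The affordability test passed by the last charged job covers all earlier charges as
  well.\<close>

lemma charges_le:
  "M * (\<Sum>y\<in>charges J v c i. card (slots y)) \<le> laxity c"
proof (cases "charges J v c i = {}")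
  case False
  let ?Y = "charges J v c i"
  have "finite ?Y" using fin by (auto simp: charges_def)
  then obtain x where x: "x \<in> ?Y" "\<forall>y\<in>?Y. key y \<le> key x"
    using False finite_max_key by metis
  have "?Y - {x} = {y \<in> ?Y. key y < key x}"
    using x by (auto simp: order_le_less)
  then have "(\<Sum>y\<in>?Y. card (slots y)) = (\<Sum>y\<in>{y \<in> ?Y. key y < key x}. card (slots y)) + card (slots x)"
    using sum.remove[OF \<open>finite ?Y\<close> x(1), of "\<lambda>y. card (slots y)"] by simp
  moreover have "affordable M J v x c" "victim_rank J v x c = i"
    using x(1) victim_Some(2)[of x c] by (auto simp: charges_def)
  ultimately show ?thesis by (simp add: affordable_def)
qed auto

text \<open>\<open>c\<close> is idle only during jobs charged to it, each at a rank below
  \<open>M\<close>; the \<open>M\<close> budgets together never exceed its laxity.\<close>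

lemma surviving_completes:
  assumes "c \<in> J"
  shows "proc_time c \<le> card {t \<in> slots c. c \<in> surviving v {j \<in> J. t \<in> slots j}}"
proof -
  let ?run = "{t \<in> slots c. c \<in> surviving v {j \<in> J. t \<in> slots j}}"
  have fin_charges: "finite (charges J v c i)" for i using fin by (auto simp: charges_def)
  have "slots c - ?run \<subseteq> (\<Union>i<M. \<Union>y\<in>charges J v c i. slots y)"
  proof
    fix t assume "t \<in> slots c - ?run"
    then obtain y where y: "y \<in> J" "t \<in> slots y" "v y = Some c"
      using assms by (auto simp: surviving_def)
    have "victim_rank J v y c < card (candidates J v y)"
      unfolding victim_rank_def using victim_Some(3)[OF y(1,3)] fin by (intro rank_less_card) auto
    then have "victim_rank J v y c < M" using card_candidates_le[OF y(1)] by simp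
    then show "t \<in> (\<Union>i<M. \<Union>y\<in>charges J v c i. slots y)"
      using y by (auto simp: charges_def)
  qed
  then have "card (slots c - ?run) \<le> card (\<Union>i<M. \<Union>y\<in>charges J v c i. slots y)"
    using fin_charges by (intro card_mono) auto
  also have "\<dots> \<le> (\<Sum>i<M. card (\<Union>y\<in>charges J v c i. slots y))"
    by (rule card_UN_le) simp
  also have "\<dots> \<le> (\<Sum>i<M. \<Sum>y\<in>charges J v c i. card (slots y))"
    by (intro sum_mono card_UN_le fin_charges)
  finally have "M * card (slots c - ?run) \<le> (\<Sum>i<M. M * (\<Sum>y\<in>charges J v c i. card (slots y)))"
    by (simp add: sum_distrib_left[symmetric])
  also have "\<dots> \<le> (\<Sum>i<M. laxity c)"
    by (intro sum_mono charges_le)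
  finally have "card (slots c - ?run) \<le> laxity c"
    using M_pos by simp
  moreover have "card (slots c - ?run) = card (slots c) - card ?run"
    by (rule card_Diff_subset) auto
  moreover have "proc_time c \<le> card (slots c)"
    using load assms by (auto simp: load_bounded_def)
  ultimately show ?thesis by (simp add: laxity_def)
qed

end

section \<open>Phases\<close>

lemma feasible_schedule_mono:
  assumes "feasible_schedule J M S" "M \<subseteq> M'"
  shows "feasible_schedule J M' S"
  using assms unfolding feasible_schedule_def by (elim conjE, intro conjI) blast+

lemma feasible_on_mono: "feasible_on J m \<Longrightarrow> m \<le> m' \<Longrightarrow> feasible_on J m'"
  unfolding feasible_on_def by (elim exE, rule exI, erule feasible_schedule_mono) simp

lemma feasible_on_subset:
  assumes "feasible_on J m" "J' \<subseteq> J"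
  shows "feasible_on J' m"
proof -
  obtain S where S: "feasible_schedule J {..<m} S"
    using assms(1) by (auto simp: feasible_on_def)
  define S' where "S' t i = (if S t i \<in> Some ` J' then S t i else None)" for t i
  have S'_iff: "S' t i = Some j \<longleftrightarrow> j \<in> J' \<and> S t i = Some j" for t i j
    by (auto simp: S'_def)
  have "feasible_schedule J' {..<m} S'"
    unfolding feasible_schedule_def
  proof (intro conjI allI impI ballI)
    fix t i j assume "S' t i = Some j"
    then have "j \<in> J'" "S t i = Some j" by (simp_all add: S'_iff)
    then show "i \<in> {..<m}" "j \<in> J'" "t \<in> job_interval j"
      using S unfolding feasible_schedule_def by blast+
  next
    fix t i i' j assume "S' t i = Some j \<and> S' t i' = Some j"
    then have "S t i = Some j \<and> S t i' = Some j" by (simp add: S'_iff)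
    then show "i = i'" using S unfolding feasible_schedule_def by blast
  next
    fix i j
    have "{t. S' t i = Some j} = (if j \<in> J' then {t. S t i = Some j} else {})"
      by (simp add: S'_iff)
    then show "{t. S' t i = Some j} \<in> sets borel"
      using S by (simp add: feasible_schedule_def)
  next
    fix j assume "j \<in> J'"
    then show "measure lborel {t. \<exists>i. S' t i = Some j} = real (proc_time j)"
      using S assms(2) unfolding feasible_schedule_def by (simp add: S'_iff subset_iff)
  qed
  then show ?thesis
    unfolding feasible_on_def by (rule exI[where x = S'])
qed

lemma feasible_on_empty: "feasible_on {} m"
proof -
  have "feasible_schedule {} {..<m} (\<lambda>_ _. None)" by (simp add: feasible_schedule_def)
  then show ?thesis unfolding feasible_on_def by (rule exI[where x = "\<lambda>_ _. None"])
qed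

text \<open>The exponent of the guessed optimum. The online model restricts information, not
  computation, so testing the known jobs for feasibility is legitimate.\<close>

definition phase :: "job set \<Rightarrow> nat" where
  "phase J = (LEAST k. feasible_on J (2 ^ k))"

lemma feasible_on_phase:
  assumes "feasible_on J m"
  shows "feasible_on J (2 ^ phase J)"
  unfolding phase_def
proof (rule LeastI)
  show "feasible_on J (2 ^ m)"
    using assms by (rule feasible_on_mono) (simp add: less_imp_le)
qed

lemma phase_mono:
  assumes "feasible_on J m" "J' \<subseteq> J"
  shows "phase J' \<le> phase J"
  unfolding phase_def[of J']
  using feasible_on_subset[OF feasible_on_phase[OF assms(1)] assms(2)] by (rule Least_le)

lemma phase_power_le:
  assumes "feasible_on J m" "0 < m"
  shows "2 ^ phase J \<le> 2 * m"
proof (cases "phase J")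
  case (Suc k)
  then have "\<not> feasible_on J (2 ^ k)"
    unfolding phase_def by (metis lessI not_less_Least)
  then have "2 ^ k < m"
    using assms(1) feasible_on_mono by (meson not_less)
  then show ?thesis using Suc by simp
qed (use assms in simp)

text \<open>The class of a job is fixed by the guess at its release; every class is scheduled
  separately with its own share of the capacity.\<close>

definition phase_class :: "job set \<Rightarrow> nat \<Rightarrow> job set" where
  "phase_class J k = {j \<in> J. phase (released_by J (release j)) = k}"

lemma phase_class_subset: "phase_class J k \<subseteq> J"
  by (auto simp: phase_class_def)

lemma released_by_released_by: "released_by (released_by J t) s = released_by J (min s t)"
  by (auto simp: released_by_def)

lemma phase_class_released_by:
  "phase_class (released_by J t) k = released_by (phase_class J k) t"
proof -
  have "released_by (released_by J t) (release j) = released_by J (release j)" if "release j \<le> t" for j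
    using that by (simp add: released_by_released_by min_absorb1)
  then show ?thesis
    unfolding phase_class_def by (auto simp: released_by_def[of _ t])
qed

text \<open>At the last release in the class, all its jobs are known and the guess is still
  \<open>k\<close>.\<close>

lemma feasible_on_phase_class:
  assumes "finite J" "feasible_on J m"
  shows "feasible_on (phase_class J k) (2 ^ k)"
proof (cases "phase_class J k = {}")
  case True
  then show ?thesis by (simp add: feasible_on_empty)
next
  case False
  let ?r = "Max (release ` phase_class J k)"
  have fin: "finite (phase_class J k)" using assms(1) phase_class_subset finite_subset by blast
  then have "?r \<in> release ` phase_class J k" using False by (intro Max_in) auto
  then have "phase (released_by J ?r) = k" by (auto simp: phase_class_def)
  moreover have "feasible_on (released_by J ?r) m"
    using assms(2) by (rule feasible_on_subset) (auto simp: released_by_def)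
  ultimately have "feasible_on (released_by J ?r) (2 ^ k)"
    using feasible_on_phase[of "released_by J ?r" m] by simp
  moreover have "phase_class J k \<subseteq> released_by J ?r"
    using fin phase_class_subset by (auto simp: released_by_def)
  ultimately show ?thesis by (rule feasible_on_subset)
qed

section \<open>Combining the classes into one slot schedule\<close>

definition loose_jobs :: "job set \<Rightarrow> job set" where
  "loose_jobs J = {j \<in> J. card (slots j) < 8 * laxity j}"

definition tight_jobs :: "job set \<Rightarrow> job set" where
  "tight_jobs J = {j \<in> J. 8 * laxity j \<le> card (slots j)}"

definition loose_size :: "nat \<Rightarrow> nat" where
  "loose_size k = 8 * 2 ^ k"

definition tight_size :: "nat \<Rightarrow> nat" where
  "tight_size k = 32 * 2 ^ k * (k + 1)"

definition capacity :: "nat \<Rightarrow> nat" where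
  "capacity k = (\<Sum>i\<le>k. loose_size i + tight_size i)"

text \<open>Each summand is at most \<open>40 * (k + 1) * 2 ^ i\<close>, and the powers of two sum
  to less than \<open>2 * 2 ^ k\<close>.\<close>

lemma capacity_le: "capacity k \<le> 80 * (k + 1) * 2 ^ k"
  by (induction k) (auto simp: capacity_def loose_size_def tight_size_def algebra_simps)

lemma capacity_mono: "k \<le> k' \<Longrightarrow> capacity k \<le> capacity k'"
  unfolding capacity_def by (intro sum_mono2) auto

text \<open>The conditions on \<open>M\<close> for \<open>m = 2 ^ k\<close> with the choice
  \<open>L = 2 * k + 6\<close>; the second rests on \<open>k + 1 \<le> 2 ^ k\<close>.\<close>

lemma tight_size_bounds:
  "(2 * k + 6 + 1) * (4 * 2 ^ k) \<le> tight_size k" "2 * tight_size k \<le> 2 ^ (2 * k + 6)"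
proof -
  show "(2 * k + 6 + 1) * (4 * 2 ^ k) \<le> tight_size k"
    by (simp add: tight_size_def algebra_simps)
  have "2 * tight_size k = 64 * 2 ^ k * (k + 1)" by (simp add: tight_size_def)
  also have "\<dots> \<le> 64 * 2 ^ k * 2 ^ k"
    using Suc_leI[OF less_exp[of k]] by (intro mult_left_mono) simp_all
  also have "\<dots> = 2 ^ (k + k + 6)" unfolding power_add by simp
  also have "k + k + 6 = 2 * k + 6" by simp
  finally show "2 * tight_size k \<le> 2 ^ (2 * k + 6)" .
qed

definition slot_run :: "job set \<Rightarrow> nat \<Rightarrow> job set" where
  "slot_run J t = (\<Union>k. edf (loose_size k) (loose_jobs (phase_class J k)) t \<union>
                        tight_run (tight_size k) (tight_jobs (phase_class J k)) t)"

lemma slot_run_subset: "slot_run J t \<subseteq> {j \<in> J. t \<in> slots j}"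
proof -
  have "loose_jobs (phase_class J k) \<subseteq> J" "tight_jobs (phase_class J k) \<subseteq> J" for k
    using phase_class_subset by (auto simp: loose_jobs_def tight_jobs_def)
  then have "edf (loose_size k) (loose_jobs (phase_class J k)) t \<subseteq> {j \<in> J. t \<in> slots j}"
    "tight_run (tight_size k) (tight_jobs (phase_class J k)) t \<subseteq> {j \<in> J. t \<in> slots j}" for k
    using edf_subset[of "loose_size k" "loose_jobs (phase_class J k)" t]
      tight_run_subset[of "tight_size k" "tight_jobs (phase_class J k)" t] by blast+
  then show ?thesis
    unfolding slot_run_def by blast
qed

lemma slot_run_released_by:
  assumes "finite J"
  shows "slot_run (released_by J t) t = slot_run J t"
proof -
  have "loose_jobs (released_by X t) = released_by (loose_jobs X) t"
    "tight_jobs (released_by X t) = released_by (tight_jobs X) t" for X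
    by (auto simp: loose_jobs_def tight_jobs_def released_by_def)
  moreover have "finite (tight_jobs (phase_class J k))" for k
    using assms by (simp add: tight_jobs_def phase_class_def)
  ultimately show ?thesis
    by (simp add: slot_run_def phase_class_released_by edf_released_by tight_run_released_by)
qed

context
  fixes J :: "job set" and m :: nat
  assumes fin: "finite J" and lam: "laminar_slots J" and feas: "feasible_on J m"
    and pos: "\<And>j. j \<in> J \<Longrightarrow> 0 < proc_time j"
begin

lemma nonempty_slots:
  assumes "j \<in> J"
  shows "slots j \<noteq> {}"
proof -
  have "0 < proc_time j" "proc_time j \<le> card (slots j)"
    using feasible_imp_load_bounded[OF feas fin] pos assms by (auto simp: load_bounded_def)
  then show ?thesis by auto
qed

lemma phase_class_props:
  shows "finite (phase_class J k)" "laminar_slots (phase_class J k)"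
    "load_bounded (2 ^ k) (phase_class J k)"
proof -
  show f: "finite (phase_class J k)" using fin phase_class_subset finite_subset by blast
  show "laminar_slots (phase_class J k)" using lam phase_class_subset by (rule laminar_slots_mono)
  show "load_bounded (2 ^ k) (phase_class J k)"
    using feasible_on_phase_class[OF fin feas] f by (rule feasible_imp_load_bounded)
qed

lemma tight_jobs_props:
  shows "finite (tight_jobs (phase_class J k))" "laminar_slots (tight_jobs (phase_class J k))"
    "load_bounded (2 ^ k) (tight_jobs (phase_class J k))"
    "\<And>j. j \<in> tight_jobs (phase_class J k) \<Longrightarrow> slots j \<noteq> {}"
    "\<And>j. j \<in> tight_jobs (phase_class J k) \<Longrightarrow> 8 * laxity j \<le> card (slots j)"
proof -
  have sub: "tight_jobs (phase_class J k) \<subseteq> phase_class J k" by (auto simp: tight_jobs_def)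
  show "finite (tight_jobs (phase_class J k))" using phase_class_props(1) sub finite_subset by blast
  show "laminar_slots (tight_jobs (phase_class J k))"
    using phase_class_props(2) sub by (rule laminar_slots_mono)
  show "load_bounded (2 ^ k) (tight_jobs (phase_class J k))"
    using phase_class_props(3,1) sub by (rule load_bounded_mono)
  show "slots j \<noteq> {}" "8 * laxity j \<le> card (slots j)" if "j \<in> tight_jobs (phase_class J k)" for j
    using that nonempty_slots sub phase_class_subset by (auto simp: tight_jobs_def)
qed

lemma loose_jobs_props:
  shows "finite (loose_jobs (phase_class J k))" "laminar_slots (loose_jobs (phase_class J k))"
    "load_bounded (2 ^ k) (loose_jobs (phase_class J k))"
proof -
  have sub: "loose_jobs (phase_class J k) \<subseteq> phase_class J k" by (auto simp: loose_jobs_def)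
  show "finite (loose_jobs (phase_class J k))" using phase_class_props(1) sub finite_subset by blast
  show "laminar_slots (loose_jobs (phase_class J k))"
    using phase_class_props(2) sub by (rule laminar_slots_mono)
  show "load_bounded (2 ^ k) (loose_jobs (phase_class J k))"
    using phase_class_props(3,1) sub by (rule load_bounded_mono)
qed

lemma card_tight_run_le: "card (tight_run (tight_size k) (tight_jobs (phase_class J k)) t) \<le> tight_size k"
  unfolding tight_run_def
  by (rule card_surviving_le[OF tight_jobs_props[where k = k] _ tight_size_bounds[of k]
        victims_is_victim_map[OF tight_jobs_props(1)[where k = k]]]) simp_all

lemma slot_run_completes:
  assumes "j \<in> J"
  shows "proc_time j \<le> card {t \<in> slots j. j \<in> slot_run J t}"
proof -
  define k where "k = phase (released_by J (release j))"
  have j: "j \<in> phase_class J k" using assms by (simp add: phase_class_def k_def)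
  have mono: "proc_time j \<le> card {t \<in> slots j. j \<in> slot_run J t}"
    if "proc_time j \<le> card {t \<in> slots j. j \<in> R t}" "\<And>t. R t \<subseteq> slot_run J t" for R
  proof -
    have "{t \<in> slots j. j \<in> R t} \<subseteq> {t \<in> slots j. j \<in> slot_run J t}" using that(2) by auto
    then have "card {t \<in> slots j. j \<in> R t} \<le> card {t \<in> slots j. j \<in> slot_run J t}"
      by (intro card_mono) auto
    then show ?thesis using that(1) by simp
  qed
  show ?thesis
  proof (cases "8 * laxity j \<le> card (slots j)")
    case True
    show ?thesis
    proof (rule mono)
      show "proc_time j \<le>
          card {t \<in> slots j. j \<in> tight_run (tight_size k) (tight_jobs (phase_class J k)) t}"
        unfolding tight_run_def
        by (rule surviving_completes[OF tight_jobs_props[where k = k] _ tight_size_bounds[of k]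
              victims_is_victim_map[OF tight_jobs_props(1)[where k = k]]])
          (use j True in \<open>simp_all add: tight_jobs_def\<close>)
    qed (auto simp: slot_run_def)
  next
    case False
    show ?thesis
    proof (rule mono)
      show "proc_time j \<le>
          card {t \<in> slots j. j \<in> edf (loose_size k) (loose_jobs (phase_class J k)) t}"
        unfolding loose_size_def
        by (rule edf_completes[OF loose_jobs_props[of k]])
          (use j False in \<open>simp_all add: loose_jobs_def\<close>)
    qed (auto simp: slot_run_def)
  qed
qed

lemma card_slot_run_le_phase: "card (slot_run J t) \<le> capacity (phase J)"
proof -
  let ?R = "\<lambda>k. edf (loose_size k) (loose_jobs (phase_class J k)) t \<union>
                 tight_run (tight_size k) (tight_jobs (phase_class J k)) t"
  \<comment> \<open>Guesses only grow with the set of known jobs, so every class beyond the final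
    guess is empty.\<close>
  have "?R k = {}" if "phase J < k" for k
  proof -
    have "phase (released_by J r) \<le> phase J" for r
      using feas by (rule phase_mono) (auto simp: released_by_def)
    then have "phase (released_by J r) \<noteq> k" for r
      using that by (metis not_le)
    then have "phase_class J k = {}" by (simp add: phase_class_def)
    then show ?thesis
      using edf_subset[of _ "{}"] tight_run_subset[of _ "{}"]
      by (simp add: loose_jobs_def tight_jobs_def)
  qed
  then have "slot_run J t \<subseteq> (\<Union>k\<le>phase J. ?R k)"
    unfolding slot_run_def using not_less by blast
  moreover have R_fin: "finite (?R k)" for k
    using finite_subset[OF edf_subset] finite_subset[OF tight_run_subset]
      loose_jobs_props(1) tight_jobs_props(1) by auto
  ultimately have "card (slot_run J t) \<le> card (\<Union>k\<le>phase J. ?R k)"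
    by (intro card_mono) auto
  also have "\<dots> \<le> (\<Sum>k\<le>phase J. card (?R k))"
    by (rule card_UN_le) simp
  also have "\<dots> \<le> capacity (phase J)"
    unfolding capacity_def
    by (intro sum_mono order_trans[OF card_Un_le] add_mono card_edf_le card_tight_run_le
        loose_jobs_props)
  finally show ?thesis .
qed

end

text \<open>Slot \<open>t\<close> depends only on the jobs known by then, so the guess for these,
  which determines the machines open at that time, suffices.\<close>

lemma card_slot_run_le:
  assumes "finite J" "laminar_slots J" "feasible_on J m" "\<And>j. j \<in> J \<Longrightarrow> 0 < proc_time j"
  shows "card (slot_run J t) \<le> capacity (phase (released_by J t))"
proof -
  have sub: "released_by J t \<subseteq> J" by (auto simp: released_by_def)
  have "card (slot_run (released_by J t) t) \<le> capacity (phase (released_by J t))"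
    by (rule card_slot_run_le_phase)
      (use assms sub in \<open>auto intro: finite_subset laminar_slots_mono feasible_on_subset\<close>)
  then show ?thesis using assms(1) by (simp add: slot_run_released_by)
qed

section \<open>The online schedule\<close>

lemma card_first_elements:
  fixes X :: "nat set"
  assumes "finite X" "p \<le> card X"
  shows "card {t \<in> X. card {s \<in> X. s < t} < p} = p"
proof -
  have "top_set (\<lambda>t. - int t) p X = {t \<in> X. card {s \<in> X. s < t} < p}"
    by (simp add: top_set_def rank_in_def)
  then show ?thesis
    using card_top_set[OF assms(1), of "\<lambda>t. - int t" p] assms(2) by (simp add: inj_on_def)
qed

text \<open>A feasible schedule must process \<open>j\<close> for exactly
  \<open>proc_time j\<close>, while \<open>slot_run\<close> may run it longer; only its first
  \<open>proc_time j\<close> slots are kept.\<close>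

definition exact_run :: "job set \<Rightarrow> nat \<Rightarrow> job set" where
  "exact_run J t = {j \<in> slot_run J t. card {s \<in> {..<t}. j \<in> slot_run J s} < proc_time j}"

lemma exact_run_released_by:
  assumes "finite J"
  shows "exact_run (released_by J t) t = exact_run J t"
proof -
  have "slot_run (released_by J t) s = slot_run J s" if "s \<le> t" for s
  proof -
    have "finite (released_by J t)" using assms by (simp add: released_by_def)
    then have "slot_run (released_by J t) s = slot_run (released_by (released_by J t) s) s"
      by (simp add: slot_run_released_by)
    also have "\<dots> = slot_run J s"
      using that assms by (simp add: released_by_released_by slot_run_released_by min_absorb1)
    finally show ?thesis .
  qed
  then have "slot_run (released_by J t) t = slot_run J t"
    "{s \<in> {..<t}. j \<in> slot_run (released_by J t) s} = {s \<in> {..<t}. j \<in> slot_run J s}" for j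
    by auto
  then show ?thesis by (simp add: exact_run_def)
qed

lemma card_exact_run_slots:
  assumes "proc_time j \<le> card {t \<in> slots j. j \<in> slot_run J t}"
  shows "finite {t. j \<in> exact_run J t}" "card {t. j \<in> exact_run J t} = proc_time j"
proof -
  let ?X = "{t \<in> slots j. j \<in> slot_run J t}"
  have "j \<in> slot_run J t \<Longrightarrow> t \<in> slots j" for t using slot_run_subset by blast
  then have "{s \<in> {..<t}. j \<in> slot_run J s} = {s \<in> ?X. s < t}" for t by auto
  then have *: "{t. j \<in> exact_run J t} = {t \<in> ?X. card {s \<in> ?X. s < t} < proc_time j}"
    using slot_run_subset by (auto simp: exact_run_def)
  show "finite {t. j \<in> exact_run J t}" unfolding * by simp
  show "card {t. j \<in> exact_run J t} = proc_time j"
    unfolding * using assms by (intro card_first_elements) auto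
qed

text \<open>Machine \<open>i\<close> takes the job of rank \<open>i\<close>, so jobs may migrate and
  the machines in use are always the lowest-numbered ones.\<close>

definition assign :: "job set \<Rightarrow> nat \<Rightarrow> job option" where
  "assign R i = (if \<exists>j\<in>R. rank_in key R j = i then Some (SOME j. j \<in> R \<and> rank_in key R j = i) else None)"

lemma assign_eq_Some_iff:
  assumes "finite R"
  shows "assign R i = Some j \<longleftrightarrow> j \<in> R \<and> rank_in key R j = i"
proof -
  have uniq: "x = y" if "x \<in> R" "y \<in> R" "rank_in key R x = rank_in key R y" for x y
    using bij_betw_rank[OF assms inj_key] that by (auto simp: bij_betw_def dest: inj_onD)
  have some: "(SOME j. j \<in> R \<and> rank_in key R j = i) = x" if "x \<in> R" "rank_in key R x = i" for x
    using that uniq by (intro some_equality) auto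
  show ?thesis
    unfolding assign_def using some by auto
qed

text \<open>Positive processing times make the intervals of a feasible instance nonempty. Jobs of
  length zero must not cause a machine to be opened, since they are feasible with
  \<open>m = 0\<close>.\<close>

definition positive_jobs :: "job set \<Rightarrow> job set" where
  "positive_jobs J = {j \<in> J. 0 < proc_time j}"

text \<open>The case \<open>J = {}\<close> opens nothing, as the bound demands for
  \<open>m = 0\<close>; \<open>capacity 0\<close> is already positive.\<close>

definition laminar_algorithm :: online_algorithm where
  "laminar_algorithm X t =
     (let J = positive_jobs X in
      (if J = {} then {} else {..<capacity (phase J)}, assign (exact_run J (nat \<lfloor>t\<rfloor>))))"

text \<open>Release dates are natural numbers, so the jobs known at \<open>t\<close> are those known
  at the start of its slot, and there are none before time 0.\<close>

lemma positive_jobs_released: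
  "positive_jobs (released J t) = (if 0 \<le> t then released_by (positive_jobs J) (nat \<lfloor>t\<rfloor>) else {})"
  by (auto simp: positive_jobs_def released_def released_by_def le_nat_iff le_floor_iff)

lemma open_machines_laminar:
  "open_machines laminar_algorithm J t =
     (if positive_jobs (released J t) = {} then {} else {..<capacity (phase (positive_jobs (released J t)))})"
  by (simp add: open_machines_def laminar_algorithm_def Let_def)

lemma online_schedule_laminar:
  assumes "finite J"
  shows "online_schedule laminar_algorithm J t i =
    (if 0 \<le> t then assign (exact_run (positive_jobs J) (nat \<lfloor>t\<rfloor>)) i else None)"
proof -
  have "exact_run {} n = {}" for n
    using slot_run_subset[of "{}" n] by (auto simp: exact_run_def)
  moreover have "finite (positive_jobs J)" using assms by (simp add: positive_jobs_def)
  ultimately show ?thesis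
    by (simp add: online_schedule_def laminar_algorithm_def Let_def positive_jobs_released
        exact_run_released_by assign_def)
qed

context
  fixes J :: "job set" and m :: nat
  assumes fin: "finite J" and lam: "laminar J" and feas: "feasible_on J m"
begin

lemma positive_jobs_props:
  shows "finite (positive_jobs J)" "laminar_slots (positive_jobs J)"
    "feasible_on (positive_jobs J) m" "\<And>j. j \<in> positive_jobs J \<Longrightarrow> 0 < proc_time j"
proof -
  have sub: "positive_jobs J \<subseteq> J" by (auto simp: positive_jobs_def)
  show "finite (positive_jobs J)" using fin sub finite_subset by blast
  show "laminar_slots (positive_jobs J)"
    using laminar_imp_laminar_slots[OF lam] sub by (rule laminar_slots_mono)
  show "feasible_on (positive_jobs J) m" using feas sub by (rule feasible_on_subset)
qed (auto simp: positive_jobs_def)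

lemma open_machines_mono: "mono (open_machines laminar_algorithm J)"
proof (rule monoI)
  fix s t :: real assume "s \<le> t"
  then have sub: "positive_jobs (released J s) \<subseteq> positive_jobs (released J t)"
    by (auto simp: positive_jobs_def released_def)
  have "feasible_on (positive_jobs (released J t)) m"
    using feas by (rule feasible_on_subset) (auto simp: positive_jobs_def released_def)
  then have "capacity (phase (positive_jobs (released J s))) \<le> capacity (phase (positive_jobs (released J t)))"
    using sub by (intro capacity_mono phase_mono)
  then show "open_machines laminar_algorithm J s \<subseteq> open_machines laminar_algorithm J t"
    using sub by (auto simp: open_machines_laminar)
qed

lemma all_opened_subset:
  "all_opened laminar_algorithm J \<subseteq>
     (if positive_jobs J = {} then {} else {..<capacity (phase (positive_jobs J))})"
proof -
  have "open_machines laminar_algorithm J t \<subseteq>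
     (if positive_jobs J = {} then {} else {..<capacity (phase (positive_jobs J))})" for t
  proof -
    have sub: "positive_jobs (released J t) \<subseteq> positive_jobs J"
      by (auto simp: positive_jobs_def released_def)
    then have "capacity (phase (positive_jobs (released J t))) \<le> capacity (phase (positive_jobs J))"
      using positive_jobs_props(3) by (intro capacity_mono phase_mono)
    then show ?thesis using sub by (auto simp: open_machines_laminar)
  qed
  then show ?thesis unfolding all_opened_def by (rule UN_least)
qed

lemma exact_run_positive: "exact_run (positive_jobs J) n \<subseteq> {j \<in> positive_jobs J. n \<in> slots j}"
  using slot_run_subset by (auto simp: exact_run_def)

lemma finite_exact_run: "finite (exact_run (positive_jobs J) n)"
  using positive_jobs_props(1) by (rule rev_finite_subset) (use exact_run_positive in auto)

lemma online_schedule_eq_Some_iff: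
  "online_schedule laminar_algorithm J t i = Some j \<longleftrightarrow>
     t \<in> unit_slots {n. j \<in> exact_run (positive_jobs J) n \<and> rank_in key (exact_run (positive_jobs J) n) j = i}"
  using assign_eq_Some_iff[OF finite_exact_run]
  by (auto simp: online_schedule_laminar[OF fin] unit_slots_def)

lemma online_schedule_open:
  assumes "online_schedule laminar_algorithm J t i = Some j"
  shows "i \<in> open_machines laminar_algorithm J t"
proof -
  let ?J = "positive_jobs J" and ?n = "nat \<lfloor>t\<rfloor>"
  have j: "0 \<le> t" "j \<in> exact_run ?J ?n" "rank_in key (exact_run ?J ?n) j = i"
    using assms by (auto simp: online_schedule_eq_Some_iff unit_slots_def)
  have "i < card (exact_run ?J ?n)"
    using rank_less_card[OF finite_exact_run j(2)] j(3) by blast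
  also have "\<dots> \<le> card (slot_run ?J ?n)"
  proof (rule card_mono)
    show "finite (slot_run ?J ?n)"
      using positive_jobs_props(1) by (rule rev_finite_subset) (use slot_run_subset in auto)
  qed (auto simp: exact_run_def)
  also have "\<dots> \<le> capacity (phase (released_by ?J ?n))"
    using positive_jobs_props by (intro card_slot_run_le) auto
  finally have "i < capacity (phase (released_by ?J ?n))" .
  moreover have "j \<in> released_by ?J ?n"
    using j(2) exact_run_positive[of ?n] by (auto simp: released_by_def slots_def)
  ultimately show ?thesis
    using j(1) by (auto simp: open_machines_laminar positive_jobs_released)
qed

lemma solves_online_laminar: "solves_online laminar_algorithm J"
proof -
  let ?S = "online_schedule laminar_algorithm J" and ?J = "positive_jobs J"
  have "measure lborel {t. \<exists>i. ?S t i = Some j} = real (proc_time j)" if "j \<in> J" for j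
  proof -
    have eq: "{t. \<exists>i. ?S t i = Some j} = unit_slots {n. j \<in> exact_run ?J n}"
      by (auto simp: online_schedule_eq_Some_iff unit_slots_def)
    show ?thesis
    proof (cases "0 < proc_time j")
      case True
      then have "j \<in> ?J" using that by (simp add: positive_jobs_def)
      then have "proc_time j \<le> card {t \<in> slots j. j \<in> slot_run ?J t}"
        using positive_jobs_props by (intro slot_run_completes) auto
      then show ?thesis
        unfolding eq using card_exact_run_slots by (simp add: measure_unit_slots)
    next
      case False
      then have "{n. j \<in> exact_run ?J n} = {}" by (auto simp: exact_run_def)
      then show ?thesis unfolding eq using False measure_unit_slots[of "{}"] by simp
    qed
  qed
  moreover have "i \<in> all_opened laminar_algorithm J \<and> j \<in> J \<and> t \<in> job_interval j"
    if "?S t i = Some j" for t i j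
    using that online_schedule_open[OF that] exact_run_positive[of "nat \<lfloor>t\<rfloor>"]
    unfolding unit_slots_slots[symmetric]
    by (auto simp: online_schedule_eq_Some_iff unit_slots_def all_opened_def positive_jobs_def)
  moreover have "{t. ?S t i = Some j} \<in> sets borel" for i j
    unfolding online_schedule_eq_Some_iff by simp
  moreover have "i = i'" if "?S t i = Some j" "?S t i' = Some j" for t i i' j
    using that by (auto simp: online_schedule_eq_Some_iff unit_slots_def)
  ultimately show ?thesis
    unfolding solves_online_def feasible_schedule_def
    using open_machines_mono online_schedule_open by fast
qed

lemma card_all_opened_le:
  "real (card (all_opened laminar_algorithm J)) \<le> 480 * max 1 (log 2 (real m)) * real m"
proof (cases "positive_jobs J = {}")
  case True
  then show ?thesis using all_opened_subset by simp
next
  case False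
  let ?J = "positive_jobs J" and ?l = "max 1 (log 2 (real m))"
  define k where "k = phase ?J"
  obtain j where j: "j \<in> ?J" using False by blast
  \<comment> \<open>A positive job excludes \<open>m = 0\<close>: the load bound on
    \<open>slots j\<close> would force its processing time to be zero.\<close>
  have m: "0 < m"
  proof (rule ccontr)
    assume "\<not> 0 < m"
    then have "load_bounded 0 ?J"
      using feasible_imp_load_bounded positive_jobs_props by auto
    then have "proc_time j \<le> card (slots j)" "card (slots j) - laxity j = 0"
      using load_boundedD[of 0 ?J "{j}" "slots j"] positive_jobs_props(1) j
      by (auto simp: load_bounded_def)
    then show False using positive_jobs_props(4)[OF j] by (simp add: laxity_def)
  qed
  have pow: "2 ^ k \<le> 2 * m"
    unfolding k_def using phase_power_le[OF positive_jobs_props(3) m] .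
  then have "real (2 ^ k) \<le> real (2 * m)" by (simp only: of_nat_le_iff)
  then have pow': "(2::real) ^ k \<le> 2 * real m" by simp
  then have "log 2 (2 ^ k) \<le> log 2 (2 * real m)"
    using m by (subst log_le_cancel_iff) auto
  then have "real k \<le> 1 + log 2 (real m)"
    using m by (simp add: log_nat_power log_mult)
  \<comment> \<open>Here \<open>k + 1 \<le> 2 + log 2 m \<le> 3 * ?l\<close>; with the factor 2 of
    \<open>pow\<close> and the 80 of \<open>capacity_le\<close> this gives 480.\<close>
  then have k_le: "real k + 1 \<le> 3 * ?l" by simp
  have "card (all_opened laminar_algorithm J) \<le> capacity k"
    using card_mono[OF _ all_opened_subset] False by (simp add: k_def)
  also have "\<dots> \<le> 80 * (k + 1) * 2 ^ k" by (rule capacity_le)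
  finally have "real (card (all_opened laminar_algorithm J)) \<le> real (80 * (k + 1) * 2 ^ k)"
    by (simp only: of_nat_le_iff)
  also have "\<dots> = 80 * ((real k + 1) * 2 ^ k)" by simp
  also have "\<dots> \<le> 80 * (3 * ?l * (2 * real m))"
    using k_le pow' by (intro mult_left_mono mult_mono) auto
  finally show ?thesis by simp
qed

lemma finite_all_opened: "finite (all_opened laminar_algorithm J)"
  using all_opened_subset by (rule finite_subset) simp

end

theorem theorem5:
  shows "\<exists>(C::real) (A::online_algorithm).
           competitive_on laminar (\<lambda>m. C * max 1 (log 2 (real m))) A"
proof (intro exI)
  show "competitive_on laminar (\<lambda>m. 480 * max 1 (log 2 (real m))) laminar_algorithm"
    unfolding competitive_on_def
    using solves_online_laminar card_all_opened_le finite_all_opened by blast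
qed

end
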